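(* Assume that there exists a chain of MSRD codes $\mathbb{M}=\mathcal{D}_1\supseteq\mathcal{D}_2\supseteq\cdots\supseteq\mathcal{D}_n$ such that $d(\mathcal{D}_h)=h$ for $h\in[n]$. A sequence of positive integers $d_1,\ldots,d_k$ is the sequence of generalized sum-rank weights of a code $\mathcal{C}\subseteq\mathbb{M}$ if and only if $d_1,\ldots,d_k$ is a non-decreasing sequence in $[n]$ such that the integer $n_1+\cdots+n_{i-1}+j$ appears in it at most $m_i$ times, for all $i\in[t]$ and $j\in[n_i]$. Moreover, the code $\mathcal{C}$ may always be chosen such that it satisfies the chain condition. In particular, any subsequence of the sequence of generalized sum-rank weights of $\mathbb{M}$ is the sequence of greedy weights of a sum-rank metric code $\mathcal{C}\subseteq\mathbb{M}$.
   Context: Write $[r]=\{1,\ldots,r\}$. Let $q$ be a prime power and let $t,n_1,\ldots,n_t,m_1,\ldots,m_t$ be positive integers with $m_1\geq\cdots\geq m_t$ and $m_i\geq n_i$ for $i\in[t]$. Let $\mathbb{M}=\mathbb{F}_q^{m_1\times n_1}\times\cdots\times\mathbb{F}_q^{m_t\times n_t}$ and $n=n_1+\cdots+n_t$. For $C=(C_1,\ldots,C_t)\in\mathbb{M}$ let $\mathrm{srk}(C)=\sum_{i=1}^t\mathrm{rk}(C_i)$. A (sum-rank metric) code is an $\mathbb{F}_q$-linear subspace $\mathcal{C}\subseteq\mathbb{M}$; a subcode is a linear subspace of a code. The minimum distance of $\mathcal{C}\neq 0$ is $d(\mathcal{C})=\min\{\mathrm{srk}(C) : C\in\mathcal{C}\setminus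 0\}$, and $\mathrm{maxsrk}(\mathcal{C})=\max\{\mathrm{srk}(C) : C\in\mathcal{C}\}$. A linear subspace $\mathcal{A}_i\subseteq\mathbb{F}_q^{m_i\times n_i}$ is an optimal anticode (OAC) if $\dim(\mathcal{A}_i)=m_i\max\{\mathrm{rk}(A) : A\in\mathcal{A}_i\}$. The weight of a code is $\mathrm{wt}(\mathcal{C})=\min\{\mathrm{maxsrk}(\mathcal{A}) : \mathcal{C}\subseteq\mathcal{A}=\mathcal{A}_1\times\cdots\times\mathcal{A}_t,\ \mathcal{A}_i\subseteq\mathbb{F}_q^{m_i\times n_i}\text{ an OAC for all }i\in[t]\}$. For $r\in[\dim(\mathcal{C})]$, the $r$-th generalized (sum-rank) weight is $d_r(\mathcal{C})=\min\{\mathrm{wt}(\mathcal{U}) : \mathcal{U}\text{ is a subcode of }\mathcal{C},\ \dim(\mathcal{U})\geq r\}$; the sequence of generalized weights of $\mathcal{C}$ is $d_1(\mathcal{C}),\ldots,d_{\dim(\mathcal{C})}(\mathcal{C})$. A code $\mathcal{C}\subseteq\mathbb{M}$ is maximum sum-rank distance (MSRD) if there exist $j\in[t]$ and $0\leq\delta\leq n_j-1$ such that $d(\mathcal{C})=\sum_{i=1}^{j-1}n_i+\delta+1$ and $\dim(\mathcal{C})=\sum_{i=j}^t m_in_i-\delta m_j$. Chain condition: a $k$-dimensional code $\mathcal{C}\neq 0$ satisfies the chain condition if there is a chain of subcodes $0\subsetneq\mathcal{U}_1\subsetneq\cdots\subsetneq\mathcal{U}_k=\mathcal{C}$ with $\mathrm{wt}(\mathcal{U}_r)=d_r(\mathcal{C})$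 for all $r\in[k]$. Greedy weights: for a $k$-dimensional code $\mathcal{C}\neq 0$, a greedy $1$-subcode is a $1$-dimensional subcode $\mathcal{U}_1$ with $\mathrm{wt}(\mathcal{U}_1)=d_1(\mathcal{C})$; for $2\leq r\leq k$ a greedy $r$-subcode is an $r$-dimensional subcode of $\mathcal{C}$ of minimum weight among those that contain a greedy $(r-1)$-subcode. The $r$-th greedy weight is $g_r(\mathcal{C})=\mathrm{wt}(\mathcal{U}_r)$ for any greedy $r$-subcode $\mathcal{U}_r$; the sequence of greedy weights is $g_1(\mathcal{C}),\ldots,g_k(\mathcal{C})$. *)

theory Defs
  imports
    "Jordan_Normal_Form.DL_Rank"
    "HOL-Library.Function_Algebras"
    "HOL-Library.Sublist"
begin

text \<open>
  An element of $F^{m_1 \times n_1} \times \cdots \times F^{m_t \times n_t}$ is a function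
  \<^term>\<open>C :: nat \<Rightarrow> nat \<Rightarrow> nat \<Rightarrow> 'a\<close>, where \<^term>\<open>C i a b\<close> is the entry of the \<^term>\<open>i\<close>-th
  matrix in row \<^term>\<open>a\<close> and column \<^term>\<open>b\<close>.  Blocks are numbered from 1 to t, while rows and
  columns are numbered from 0, as in \<^const>\<open>mat\<close>.  All values outside these ranges are 0, so
  that the representation is unique and the vector space structure is the pointwise one.
\<close>

type_synonym 'a block = "nat \<Rightarrow> nat \<Rightarrow> 'a"
type_synonym 'a codeword = "nat \<Rightarrow> 'a block"

definition block_scale :: "'a::field \<Rightarrow> 'a block \<Rightarrow> 'a block" where
  "block_scale c A = (\<lambda>a b. c * A a b)"

definition cw_scale :: "'a::field \<Rightarrow> 'a codeword \<Rightarrow> 'a codeword" where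
  "cw_scale c C = (\<lambda>i a b. c * C i a b)"

global_interpretation block: vector_space "block_scale :: 'a::field \<Rightarrow> _"
  by unfold_locales (auto simp: block_scale_def fun_eq_iff algebra_simps)

global_interpretation cw: vector_space "cw_scale :: 'a::field \<Rightarrow> _"
  by unfold_locales (auto simp: cw_scale_def fun_eq_iff algebra_simps)

definition blocks :: "nat \<Rightarrow> nat \<Rightarrow> 'a::field block set" where
  "blocks m n = {A. \<forall>a b. \<not> (a < m \<and> b < n) \<longrightarrow> A a b = 0}"

definition rk :: "nat \<Rightarrow> nat \<Rightarrow> 'a::field block \<Rightarrow> nat" where
  "rk m n A = vec_space.rank m (mat m n (\<lambda>(a, b). A a b))"

definition prod_code :: "nat \<Rightarrow> (nat \<Rightarrow> 'a::field block set) \<Rightarrow> 'a codeword set" where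
  "prod_code t \<A> = {C. (\<forall>i\<in>{1..t}. C i \<in> \<A> i) \<and> (\<forall>i. i \<notin> {1..t} \<longrightarrow> C i = 0)}"

definition ambient :: "nat \<Rightarrow> (nat \<Rightarrow> nat) \<Rightarrow> (nat \<Rightarrow> nat) \<Rightarrow> 'a::field codeword set" where
  "ambient t m n = prod_code t (\<lambda>i. blocks (m i) (n i))"

definition srk :: "nat \<Rightarrow> (nat \<Rightarrow> nat) \<Rightarrow> (nat \<Rightarrow> nat) \<Rightarrow> 'a::field codeword \<Rightarrow> nat" where
  "srk t m n C = (\<Sum>i = 1..t. rk (m i) (n i) (C i))"

definition is_code :: "nat \<Rightarrow> (nat \<Rightarrow> nat) \<Rightarrow> (nat \<Rightarrow> nat) \<Rightarrow> 'a::field codeword set \<Rightarrow> bool" where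
  "is_code t m n \<C> \<longleftrightarrow> \<C> \<subseteq> ambient t m n \<and> cw.subspace \<C>"

definition subcode :: "'a::field codeword set \<Rightarrow> 'a codeword set \<Rightarrow> bool" where
  "subcode \<U> \<C> \<longleftrightarrow> \<U> \<subseteq> \<C> \<and> cw.subspace \<U>"

text \<open>
  The minimum of a nonempty set of natural numbers is written \<^const>\<open>Inf\<close>.  In particular,
  \<open>min_dist\<close> is meaningful for nonzero codes only.
\<close>

definition min_dist :: "nat \<Rightarrow> (nat \<Rightarrow> nat) \<Rightarrow> (nat \<Rightarrow> nat) \<Rightarrow> 'a::field codeword set \<Rightarrow> nat" where
  "min_dist t m n \<C> = Inf (srk t m n ` (\<C> - {0}))"

definition maxsrk :: "nat \<Rightarrow> (nat \<Rightarrow> nat) \<Rightarrow> (nat \<Rightarrow> nat) \<Rightarrow> 'a::field codeword set \<Rightarrow> nat" where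
  "maxsrk t m n \<C> = Max (srk t m n ` \<C>)"

definition OAC :: "nat \<Rightarrow> nat \<Rightarrow> 'a::field block set \<Rightarrow> bool" where
  "OAC m n \<A> \<longleftrightarrow>
     \<A> \<subseteq> blocks m n \<and> block.subspace \<A> \<and> block.dim \<A> = m * Max (rk m n ` \<A>)"

definition wt :: "nat \<Rightarrow> (nat \<Rightarrow> nat) \<Rightarrow> (nat \<Rightarrow> nat) \<Rightarrow> 'a::field codeword set \<Rightarrow> nat" where
  "wt t m n \<C> =
     Inf {maxsrk t m n (prod_code t \<A>) | \<A>.
            (\<forall>i\<in>{1..t}. OAC (m i) (n i) (\<A> i)) \<and> \<C> \<subseteq> prod_code t \<A>}"

definition gen_weight ::
  "nat \<Rightarrow> (nat \<Rightarrow> nat) \<Rightarrow> (nat \<Rightarrow> nat) \<Rightarrow> 'a::field codeword set \<Rightarrow> nat \<Rightarrow> nat" where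
  "gen_weight t m n \<C> r = Inf {wt t m n \<U> | \<U>. subcode \<U> \<C> \<and> r \<le> cw.dim \<U>}"

definition gen_weights ::
  "nat \<Rightarrow> (nat \<Rightarrow> nat) \<Rightarrow> (nat \<Rightarrow> nat) \<Rightarrow> 'a::field codeword set \<Rightarrow> nat list" where
  "gen_weights t m n \<C> = map (gen_weight t m n \<C>) [1..<Suc (cw.dim \<C>)]"

definition MSRD :: "nat \<Rightarrow> (nat \<Rightarrow> nat) \<Rightarrow> (nat \<Rightarrow> nat) \<Rightarrow> 'a::field codeword set \<Rightarrow> bool" where
  "MSRD t m n \<C> \<longleftrightarrow> is_code t m n \<C> \<and>
     (\<exists>j\<in>{1..t}. \<exists>\<delta>. \<delta> \<le> n j - 1 \<and>
        min_dist t m n \<C> = (\<Sum>i = 1..<j. n i) + \<delta> + 1 \<and>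
        cw.dim \<C> = (\<Sum>i = j..t. m i * n i) - \<delta> * m j)"

definition chain_condition ::
  "nat \<Rightarrow> (nat \<Rightarrow> nat) \<Rightarrow> (nat \<Rightarrow> nat) \<Rightarrow> 'a::field codeword set \<Rightarrow> bool" where
  "chain_condition t m n \<C> \<longleftrightarrow> \<C> \<noteq> {0} \<and>
     (\<exists>\<U>. {0} \<subset> \<U> 1 \<and> (\<forall>r\<in>{1..<cw.dim \<C>}. \<U> r \<subset> \<U> (Suc r)) \<and> \<U> (cw.dim \<C>) = \<C> \<and>
        (\<forall>r\<in>{1..cw.dim \<C>}. subcode (\<U> r) \<C> \<and> wt t m n (\<U> r) = gen_weight t m n \<C> r))"

text \<open>Greedy subcodes exist in positive dimension only; index 0 is a dummy case.\<close>

fun greedy_subcodes ::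
  "nat \<Rightarrow> (nat \<Rightarrow> nat) \<Rightarrow> (nat \<Rightarrow> nat) \<Rightarrow> 'a::field codeword set \<Rightarrow> nat \<Rightarrow> 'a codeword set set"
where
  "greedy_subcodes t m n \<C> 0 = {}"
| "greedy_subcodes t m n \<C> (Suc 0) =
     {\<U>. subcode \<U> \<C> \<and> cw.dim \<U> = 1 \<and> wt t m n \<U> = gen_weight t m n \<C> 1}"
| "greedy_subcodes t m n \<C> (Suc (Suc r)) =
     (let \<S> = {\<U>. subcode \<U> \<C> \<and> cw.dim \<U> = Suc (Suc r) \<and>
                   (\<exists>\<V>\<in>greedy_subcodes t m n \<C> (Suc r). \<V> \<subseteq> \<U>)}
      in {\<U>\<in>\<S>. \<forall>\<V>\<in>\<S>. wt t m n \<U> \<le> wt t m n \<V>})"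

text \<open>The choice made in the definition of the greedy weights is immaterial.\<close>

lemma greedy_subcodes_wt_unique:
  assumes "\<U> \<in> greedy_subcodes t m n \<C> r" "\<V> \<in> greedy_subcodes t m n \<C> r"
  shows "wt t m n \<U> = wt t m n \<V>"
proof (cases "(t, m, n, \<C>, r)" rule: greedy_subcodes.cases)
  case (3 t' m' n' \<C>' s)
  with assms have "wt t m n \<U> \<le> wt t m n \<V>" "wt t m n \<V> \<le> wt t m n \<U>"
    by (simp_all add: Let_def)
  then show ?thesis by simp
qed (use assms in auto)

definition greedy_weight ::
  "nat \<Rightarrow> (nat \<Rightarrow> nat) \<Rightarrow> (nat \<Rightarrow> nat) \<Rightarrow> 'a::field codeword set \<Rightarrow> nat \<Rightarrow> nat" where
  "greedy_weight t m n \<C> r = wt t m n (SOME \<U>. \<U> \<in> greedy_subcodes t m n \<C> r)"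

definition greedy_weights ::
  "nat \<Rightarrow> (nat \<Rightarrow> nat) \<Rightarrow> (nat \<Rightarrow> nat) \<Rightarrow> 'a::field codeword set \<Rightarrow> nat list" where
  "greedy_weights t m n \<C> = map (greedy_weight t m n \<C>) [1..<Suc (cw.dim \<C>)]"

definition admissible_seq :: "nat \<Rightarrow> (nat \<Rightarrow> nat) \<Rightarrow> (nat \<Rightarrow> nat) \<Rightarrow> nat list \<Rightarrow> bool" where
  "admissible_seq t m n ds \<longleftrightarrow>
     sorted ds \<and> set ds \<subseteq> {1..\<Sum>i = 1..t. n i} \<and>
     (\<forall>i\<in>{1..t}. \<forall>j\<in>{1..n i}. count_list ds ((\<Sum>l = 1..<i. n l) + j) \<le> m i)"

end

theory Submission
  imports Defs "HOL-Library.Cardinality"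
begin

text \<open>
  Realizing a sequence: the matrices supported in the first \<open>h\<close> of the \<open>n\<close> columns form an optimal
  anticode of rank \<open>h\<close>, and its intersection with \<open>D h\<close> has dimension at least \<open>m i\<close>, where column
  \<open>h\<close> lies in block \<open>i\<close>. Choosing for each entry \<open>h\<close> of the sequence one vector in this intersection
  gives a code with a flag of the prescribed weights; no subcode does better, since an optimal
  anticode of rank \<open>s\<close> meets \<open>D (s + 1)\<close> trivially. The members of the flag are greedy subcodes.

  Necessity: from a product of optimal anticodes of total rank \<open>h > n 1 + \<dots> + n (i - 1)\<close>, some factor
  with index \<open>l \<ge> i\<close> can be replaced by an optimal anticode of rank one less, which costs
  \<open>m l \<le> m i\<close> dimensions and lowers the weight. That the smaller anticode exists follows from the
  classification of optimal anticodes: they are given by a row space or, in the square case, by a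
  column space. It is proved over a finite field by induction, deleting rows and clearing
  rank-one matrices, with dimensions expressed by cardinalities.
\<close>

subsection \<open>Cardinalities of subspaces\<close>

text \<open>The obstacle is that the smaller anticode must lie inside the given one. Optimality is
  only an equality of dimensions, so lowering the rank requires knowing what an anticode attaining
  the bound looks like, and the bound and its equality case have to be followed through the same
  reductions. Tall matrices behave uniformly; for square ones deleting a row makes the format wide,
  which is repaired by transposing, and this is how the column type arises. Counting elements serves
  two purposes. Fibres of additive maps replace rank-nullity for row deletion, and a set of q^s
  vectors cannot lie in the span of fewer than s vectors, which allows independent vectors to be
  picked one at a time from large subspaces over every finite field, including the one with two
  elements. In the construction, the lower bound m i is a surplus of dimensions: those of
  \<open>D h\<close> and of the matrices supported in the first h columns add up to m i more than
  the dimension of the whole space. It equals the multiplicity allowed to h, so each occurrence of h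
  finds a new vector.\<close>

lemma card_functions_with_support:
  fixes X :: "'i \<Rightarrow> 'b::zero set"
  assumes "finite S"
  shows "card {f. (\<forall>i\<in>S. f i \<in> X i) \<and> (\<forall>i. i \<notin> S \<longrightarrow> f i = 0)} = (\<Prod>i\<in>S. card (X i))"
proof -
  let ?F = "{f. (\<forall>i\<in>S. f i \<in> X i) \<and> (\<forall>i. i \<notin> S \<longrightarrow> f i = 0)}"
  let ?e = "\<lambda>g i. if i \<in> S then g i else 0"
  have "bij_betw (\<lambda>f. restrict f S) ?F (PiE S X)"
  proof (rule bij_betw_byWitness[where f' = ?e])
    show "\<forall>f\<in>?F. ?e (restrict f S) = f"
      by (intro ballI ext) simp
    show "\<forall>g\<in>PiE S X. restrict (?e g) S = g"
    proof (intro ballI ext)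
      fix g x assume "g \<in> PiE S X"
      then have "x \<notin> S \<Longrightarrow> g x = undefined" by (rule PiE_arb)
      then show "restrict (?e g) S x = g x" by (simp add: restrict_def)
    qed
    show "(\<lambda>f. restrict f S) ` ?F \<subseteq> PiE S X"
      by (rule image_subsetI) simp
    show "?e ` PiE S X \<subseteq> ?F"
    proof (rule image_subsetI)
      fix g assume "g \<in> PiE S X"
      then have "\<And>i. i \<in> S \<Longrightarrow> g i \<in> X i" by (rule PiE_mem)
      then show "?e g \<in> ?F" by simp
    qed
  qed
  from bij_betw_same_card[OF this] show ?thesis
    by (simp only: card_PiE[OF assms])
qed

lemma finite_functions_with_support:
  fixes X :: "'i \<Rightarrow> 'b::zero set"
  assumes "finite S" "\<And>i. i \<in> S \<Longrightarrow> finite (X i)"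
  shows "finite {f. (\<forall>i\<in>S. f i \<in> X i) \<and> (\<forall>i. i \<notin> S \<longrightarrow> f i = 0)}"
proof (rule finite_subset)
  show "{f. (\<forall>i\<in>S. f i \<in> X i) \<and> (\<forall>i. i \<notin> S \<longrightarrow> f i = 0)} \<subseteq> (\<lambda>g i. if i \<in> S then g i else 0) ` PiE S X"
  proof
    fix f assume f: "f \<in> {f. (\<forall>i\<in>S. f i \<in> X i) \<and> (\<forall>i. i \<notin> S \<longrightarrow> f i = 0)}"
    have "f = (\<lambda>i. if i \<in> S then restrict f S i else 0)"
      using f by (intro ext) simp
    moreover have "restrict f S \<in> PiE S X" using f by simp
    ultimately
    show "f \<in> (\<lambda>g i. if i \<in> S then g i else 0) ` PiE S X" by blast
  qed
  show "finite ((\<lambda>g i. if i \<in> S then g i else 0) ` PiE S X)"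
    using assms by (simp add: finite_PiE)
qed

text \<open>All fibres over the image are translates of the kernel. Only closure under
  \<open>+\<close> and \<open>-\<close> and additivity on \<open>V\<close> are asked for, so the
  same count serves row deletion and clearing.\<close>

lemma card_kernel_image:
  fixes g :: "'b::ab_group_add \<Rightarrow> 'c::ab_group_add"
  assumes fin: "finite V"
    and add: "\<And>x y. x \<in> V \<Longrightarrow> y \<in> V \<Longrightarrow> x + y \<in> V"
    and diff: "\<And>x y. x \<in> V \<Longrightarrow> y \<in> V \<Longrightarrow> x - y \<in> V"
    and g: "\<And>x y. x \<in> V \<Longrightarrow> y \<in> V \<Longrightarrow> g (x + y) = g x + g y"
  shows "card V = card {x\<in>V. g x = 0} * card (g ` V)"
proof -
  have gd: "g (x - y) = g x - g y" if "x \<in> V" "y \<in> V" for x y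
    using g[OF diff[OF that] that(2)] by (simp add: algebra_simps)
  have fibre: "card {x\<in>V. g x = g y} = card {x\<in>V. g x = 0}" if "y \<in> V" for y
  proof (rule bij_betw_same_card)
    show "bij_betw (\<lambda>x. x - y) {x\<in>V. g x = g y} {x\<in>V. g x = 0}"
      by (rule bij_betw_byWitness[where f' = "\<lambda>x. x + y"])
         (use that in \<open>auto simp: add diff g gd\<close>)
  qed
  have "card V = (\<Sum>z\<in>g ` V. card {x\<in>V. g x = z})"
    using sum.image_gen[OF fin, of "\<lambda>_. 1::nat" g] by simp
  also have "\<dots> = (\<Sum>z\<in>g ` V. card {x\<in>V. g x = 0})"
    by (rule sum.cong) (use fibre in auto)
  finally show ?thesis by simp
qed

lemma two_le_card_field: "2 \<le> card (UNIV :: 'a::{finite,field} set)"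
proof -
  have "card {0, 1::'a} \<le> CARD('a)" by (rule card_mono) auto
  then show ?thesis by simp
qed

context vector_space
begin

lemma card_span_independent:
  assumes "finite B" "independent B" "finite (UNIV :: 'a set)"
  shows "finite (span B) \<and> card (span B) = CARD('a) ^ card B"
  using assms(1,2)
proof (induction B rule: finite_induct)
  case (insert b B)
  then have b: "b \<notin> span B" and B: "independent B"
    by (simp_all add: independent_insert)
  then have IH: "finite (span B)" "card (span B) = CARD('a) ^ card B"
    using insert by auto
  let ?g = "\<lambda>(k, x). scale k b + x"
  have sp: "span (insert b B) = ?g ` (UNIV \<times> span B)"
  proof
    show "span (insert b B) \<subseteq> ?g ` (UNIV \<times> span B)"
    proof
      fix x assume "x \<in> span (insert b B)"
      then obtain k where "x - scale k b \<in> span B" by (auto simp: span_breakdown_eq)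
      then have "x = ?g (k, x - scale k b)" "(k, x - scale k b) \<in> UNIV \<times> span B" by auto
      then show "x \<in> ?g ` (UNIV \<times> span B)" by blast
    qed
    show "?g ` (UNIV \<times> span B) \<subseteq> span (insert b B)"
      by (auto simp: span_breakdown_eq) (metis add_diff_cancel_left')
  qed
  have "inj_on ?g (UNIV \<times> span B)"
  proof (rule inj_onI, clarify)
    fix k x l y assume xy: "x \<in> span B" "y \<in> span B" and e: "scale k b + x = scale l b + y"
    then have *: "scale (k - l) b = y - x" by (simp add: algebra_simps)
    then have "scale (k - l) b \<in> span B" using xy by (simp add: span_diff)
    then have "k = l"
      using b span_scale[of "scale (k - l) b" B "inverse (k - l)"] by (cases "k = l") auto
    with e show "k = l \<and> x = y" by simp
  qed
  then have "card (span (insert b B)) = CARD('a) * card (span B)"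
    by (simp add: sp card_image card_cartesian_product)
  with IH insert(1,2) show ?case
    using assms(3) by (simp add: sp finite_cartesian_product)
qed simp

lemma card_subspace_eq:
  assumes "subspace V" "finite V" "finite (UNIV :: 'a set)"
  shows "card V = CARD('a) ^ dim V"
proof -
  obtain B where B: "B \<subseteq> V" "independent B" "V \<subseteq> span B" "card B = dim V"
    using basis_exists by blast
  then have "span B = V" using span_minimal assms(1) by blast
  then show ?thesis using card_span_independent[of B] B assms finite_subset by metis
qed

text \<open>The basis is returned along with its span because \<open>card B = r\<close> is what
  later bounds the rank of matrices whose rows lie in this span.\<close>

lemma subspace_contains_smaller_span:
  assumes "subspace V" "card V = CARD('a) ^ Suc r" "finite (UNIV :: 'a set)"
  obtains B where "finite B" "independent B" "card B = r" "span B \<subseteq> V" "card (span B) = CARD('a) ^ r"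
proof -
  have "CARD('a) > 0" using assms(3) by (simp add: finite_UNIV_card_ge_0)
  then have finV: "finite V" using assms(2) by (metis card.infinite power_not_zero less_numeral_extra(3))
  have "card {0, 1 :: 'a} \<le> CARD('a)" by (rule card_mono) (auto simp: assms)
  then have q: "CARD('a) \<ge> 2" by simp
  obtain B where B: "B \<subseteq> V" "independent B" "V \<subseteq> span B" "card B = dim V"
    using basis_exists by blast
  have "dim V = Suc r"
    using card_subspace_eq[OF assms(1) finV assms(3)] assms(2) q
    by (metis power_inject_exp less_le_trans one_less_numeral_iff semiring_norm(76))
  then obtain B' where B': "B' \<subseteq> B" "card B' = r" "finite B'"
    using B(4) by (metis lessI less_imp_le obtain_subset_with_card_n)
  then have ind: "independent B'" using B(2) independent_mono by blast
  then have "card (span B') = CARD('a) ^ r"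
    using card_span_independent[of B'] B' assms(3) by auto
  moreover have "span B' \<subseteq> V" using B B' assms(1) by (meson order_trans span_minimal)
  ultimately show thesis using that[of B'] B' ind by simp
qed

end

section \<open>Linearly independent families of vectors\<close>

definition fv_scale :: "'a::field \<Rightarrow> (nat \<Rightarrow> 'a) \<Rightarrow> nat \<Rightarrow> 'a" where
  "fv_scale c v = (\<lambda>b. c * v b)"

global_interpretation fv: vector_space "fv_scale :: 'a::field \<Rightarrow> _"
  by unfold_locales (auto simp: fv_scale_def fun_eq_iff algebra_simps)

lemma sum_fun_apply: "(\<Sum>i\<in>S. f i) x = (\<Sum>i\<in>S. f i x)"
  by (induction S rule: infinite_finite_induct) auto

text \<open>Families rather than sets: two equal rows of a matrix are a single element of a set of
  vectors, but have to count as a dependence.\<close>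

definition fam_indep :: "'i set \<Rightarrow> ('i \<Rightarrow> nat \<Rightarrow> 'a::field) \<Rightarrow> bool" where
  "fam_indep S f \<longleftrightarrow> (\<forall>c. (\<forall>x. (\<Sum>i\<in>S. c i * f i x) = 0) \<longrightarrow> (\<forall>i\<in>S. c i = 0))"

lemma fam_indepD:
  assumes "fam_indep S f" "\<And>x. (\<Sum>i\<in>S. c i * f i x) = 0" "i \<in> S"
  shows "c i = 0"
  using assms unfolding fam_indep_def by blast

lemma fam_indep_cong:
  assumes "\<And>i. i \<in> S \<Longrightarrow> f i = g i"
  shows "fam_indep S f = fam_indep S g"
  unfolding fam_indep_def using assms by (simp cong: sum.cong)

lemma fam_indep_iff:
  fixes f :: "'i \<Rightarrow> nat \<Rightarrow> 'a::field"
  assumes fin: "finite S"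
  shows "fam_indep S f \<longleftrightarrow> inj_on f S \<and> fv.independent (f ` S)"
proof
  assume ind: "fam_indep S f"
  have inj: "inj_on f S"
  proof (rule inj_onI, rule ccontr)
    fix i j assume ij: "i \<in> S" "j \<in> S" "f i = f j" "i \<noteq> j"
    have "(\<Sum>k\<in>S. (if k = i then 1 else if k = j then -1 else 0) * f k x) = 0" for x
    proof -
      have "(\<Sum>k\<in>S. (if k = i then 1 else if k = j then -1 else 0) * f k x)
          = (\<Sum>k\<in>{i,j}. (if k = i then 1 else if k = j then -1 else 0) * f k x)"
        by (rule sum.mono_neutral_right) (use ij fin in auto)
      also have "\<dots> = 0" using ij by auto
      finally show ?thesis .
    qed
    from fam_indepD[OF ind this ij(1)] show False by simp
  qed
  moreover have "fv.independent (f ` S)"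
  proof -
    have "u v = 0" if s: "(\<Sum>v\<in>f ` S. fv_scale (u v) v) = 0" and v: "v \<in> f ` S" for u v
    proof -
      have "(\<Sum>i\<in>S. u (f i) * f i x) = 0" for x
        using fun_cong[OF s, of x] by (simp add: sum.reindex[OF inj] sum_fun_apply fv_scale_def)
      from fam_indepD[OF ind this] v show ?thesis by auto
    qed
    then show ?thesis using fin by (auto simp: fv.dependent_finite)
  qed
  ultimately show "inj_on f S \<and> fv.independent (f ` S)" ..
next
  assume r: "inj_on f S \<and> fv.independent (f ` S)"
  show "fam_indep S f"
    unfolding fam_indep_def
  proof (intro allI impI ballI)
    fix c i assume c: "\<forall>x. (\<Sum>i\<in>S. c i * f i x) = 0" and i: "i \<in> S"
    define u where "u = (\<lambda>v. c (inv_into S f v))"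
    have uf: "u (f j) = c j" if "j \<in> S" for j
      using r that by (simp add: u_def)
    have "(\<Sum>v\<in>f ` S. fv_scale (u v) v) = (\<Sum>j\<in>S. fv_scale (u (f j)) (f j))"
      using r by (simp add: sum.reindex)
    also have "\<dots> = (\<Sum>j\<in>S. fv_scale (c j) (f j))"
      by (rule sum.cong) (simp_all add: uf)
    also have "\<dots> = 0"
      using c by (auto simp: fun_eq_iff sum_fun_apply fv_scale_def)
    finally have "(\<Sum>v\<in>f ` S. fv_scale (u v) v) = 0" .
    moreover have "\<not> (\<exists>u. (\<exists>v\<in>f ` S. u v \<noteq> 0) \<and> (\<Sum>v\<in>f ` S. fv_scale (u v) v) = 0)"
      using r fv.dependent_finite[of "f ` S"] fin by simp
    ultimately have "\<forall>v\<in>f ` S. u v = 0" by blast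
    then show "c i = 0" using uf[OF i] i by auto
  qed
qed

lemma fam_indep_empty [simp]: "fam_indep {} f"
  by (simp add: fam_indep_def)

lemma fam_indep_insert:
  assumes "fam_indep S f" "finite S" "i \<notin> S" "v \<notin> fv.span (f ` S)"
  shows "fam_indep (insert i S) (f(i := v))"
proof -
  have "(f(i := v)) ` insert i S = insert v (f ` S)" using assms(3) by auto
  moreover have "v \<notin> f ` S" using assms(4) fv.span_base by blast
  ultimately show ?thesis using assms
    by (auto simp: fam_indep_iff fv.independent_insert inj_on_def)
qed

lemma card_span_fam:
  fixes f :: "'i \<Rightarrow> nat \<Rightarrow> 'a::{finite,field}"
  assumes "fam_indep S f" "finite S"
  shows "finite (fv.span (f ` S))" "card (fv.span (f ` S)) = CARD('a) ^ card S"
  using assms fv.card_span_independent[of "f ` S"] by (auto simp: fam_indep_iff card_image)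

text \<open>Fewer than \<open>s\<close> vectors span fewer than \<open>CARD('a) ^ s\<close>
  elements, so every \<open>\<Phi> i\<close> contains a vector outside the span of those chosen so
  far. The vectors indexed by \<open>T\<close> are prescribed in advance.\<close>

lemma fam_indep_extend:
  fixes f :: "'i \<Rightarrow> nat \<Rightarrow> 'a::{finite,field}"
  assumes "finite S" "finite T" "S \<inter> T = {}" "fam_indep T f" "card T + card S \<le> s"
    and "\<And>i. i \<in> S \<Longrightarrow> CARD('a) ^ s \<le> card (\<Phi> i)"
  shows "\<exists>g. (\<forall>i. i \<notin> S \<longrightarrow> g i = f i) \<and> (\<forall>i\<in>S. g i \<in> \<Phi> i) \<and> fam_indep (S \<union> T) g"
  using assms
proof (induction S rule: finite_induct)
  case empty
  then show ?case by (intro exI[of _ f]) simp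
next
  case (insert i S)
  have "\<exists>g. (\<forall>i. i \<notin> S \<longrightarrow> g i = f i) \<and> (\<forall>i\<in>S. g i \<in> \<Phi> i) \<and> fam_indep (S \<union> T) g"
    by (rule insert.IH) (use insert.prems insert.hyps in auto)
  then obtain g where g: "\<forall>i. i \<notin> S \<longrightarrow> g i = f i" "\<forall>i\<in>S. g i \<in> \<Phi> i" "fam_indep (S \<union> T) g"
    by blast
  have "card (S \<union> T) < s"
    using insert.prems insert.hyps card_Un_le[of S T] by simp
  then have "CARD('a) ^ card (S \<union> T) < CARD('a) ^ s"
    using two_le_card_field[where 'a='a] by (intro power_strict_increasing) auto
  also have "\<dots> \<le> card (\<Phi> i)" using insert.prems by simp
  finally have lt: "CARD('a) ^ card (S \<union> T) < card (\<Phi> i)" .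
  have "finite (S \<union> T)" using insert.hyps insert.prems by simp
  note sp = card_span_fam[OF g(3) this]
  have "\<not> \<Phi> i \<subseteq> fv.span (g ` (S \<union> T))"
    using card_mono[OF sp(1), of "\<Phi> i"] sp(2) lt by auto
  then obtain v where v: "v \<in> \<Phi> i" "v \<notin> fv.span (g ` (S \<union> T))" by blast
  have fi: "fam_indep (insert i S \<union> T) (g(i := v))"
    unfolding Un_insert_left
    by (rule fam_indep_insert) (use insert.hyps insert.prems(1,2) g(3) v(2) in simp_all)
  show ?case
  proof (intro exI conjI)
    show "fam_indep (insert i S \<union> T) (g(i := v))" by (rule fi)
    show "\<forall>j. j \<notin> insert i S \<longrightarrow> (g(i := v)) j = f j" using g(1) by simp
    show "\<forall>j\<in>insert i S. (g(i := v)) j \<in> \<Phi> j" using g(2) v(1) by simp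
  qed
qed

subsection \<open>Rank\<close>

text \<open>Factorization through an \<open>r\<close>-dimensional space. The form is symmetric in
  rows and columns, so transposing swaps the factors, and it refers to no matrix format, so rows and
  columns can be zeroed without renumbering.\<close>

definition rank_le :: "nat \<Rightarrow> 'a::field block \<Rightarrow> bool" where
  "rank_le r M \<longleftrightarrow> (\<exists>u v. \<forall>a b. M a b = (\<Sum>k<r. u k a * v k b))"

abbreviation (input) btransp :: "'a block \<Rightarrow> 'a block" where
  "btransp M \<equiv> (\<lambda>b a. M a b)"

lemma rank_le_transp:
  assumes "rank_le r M" shows "rank_le r (btransp M)"
proof -
  obtain u v where "\<And>a b. M a b = (\<Sum>k<r. u k a * v k b)"
    using assms unfolding rank_le_def by blast
  then show ?thesis
    unfolding rank_le_def by (intro exI[of _ v] exI[of _ u]) (simp add: mult.commute)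
qed

lemma rank_le_card_rows:
  assumes "rank_le r M" "finite S" "fam_indep S M"
  shows "card S \<le> r"
proof -
  obtain u v where uv: "\<And>a b. M a b = (\<Sum>k<r. u k a * v k b)"
    using assms(1) unfolding rank_le_def by blast
  have Ma: "M a = (\<Sum>k<r. fv_scale (u k a) (v k))" for a
    using uv by (auto simp: fun_eq_iff sum_fun_apply fv_scale_def)
  have "M a \<in> fv.span (v ` {..<r})" for a
    unfolding Ma by (intro fv.span_sum fv.span_scale fv.span_base imageI)
  then have "card (M ` S) \<le> card (v ` {..<r})"
    using fv.independent_span_bound[of "v ` {..<r}" "M ` S"] assms by (auto simp: fam_indep_iff)
  also have "\<dots> \<le> r" using card_image_le[of "{..<r}" v] by simp
  finally show ?thesis using assms by (auto simp: fam_indep_iff card_image)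
qed

lemma rank_le_card_cols:
  "rank_le r M \<Longrightarrow> finite S \<Longrightarrow> fam_indep S (btransp M) \<Longrightarrow> card S \<le> r"
  using rank_le_card_rows rank_le_transp by blast

lemma rank_leI_span:
  assumes "finite B" "card B \<le> r" "\<And>a. M a \<in> fv.span B"
  shows "rank_le r M"
proof -
  obtain w where w: "M a = (\<Sum>x\<in>B. fv_scale (w a x) x)" for a
    using assms(1,3) by (simp add: fv.span_finite image_iff) metis
  obtain e where e: "bij_betw e {..<card B} B"
    using ex_bij_betw_nat_finite[OF assms(1)] by (metis atLeast0LessThan)
  have "M a b = (\<Sum>k<r. (if k < card B then w a (e k) else 0) * e k b)" for a b
  proof -
    have "M a b = (\<Sum>x\<in>B. w a x * x b)"
      by (subst w) (simp add: sum_fun_apply fv_scale_def)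
    also have "\<dots> = (\<Sum>k<card B. w a (e k) * e k b)"
      using sum.reindex_bij_betw[OF e, of "\<lambda>x. w a x * x b"] by simp
    also have "\<dots> = (\<Sum>k<r. (if k < card B then w a (e k) else 0) * e k b)"
      by (rule sum.mono_neutral_cong_left) (use assms(2) in auto)
    finally show ?thesis .
  qed
  then show ?thesis unfolding rank_le_def
    by (intro exI[of _ "\<lambda>k a. if k < card B then w a (e k) else 0"] exI[of _ e]) auto
qed

text \<open>A maximal independent set of rows is pulled back along \<open>M\<close> to a set of row
  indices. Finiteness of the range makes this set finite although \<open>M\<close> has a row for
  every natural number.\<close>

lemma rank_leI:
  assumes fin: "finite (range M)"
    and le: "\<And>S. finite S \<Longrightarrow> fam_indep S M \<Longrightarrow> card S \<le> r"
  shows "rank_le r M"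
proof -
  obtain B where B: "B \<subseteq> range M" "fv.independent B" "range M \<subseteq> fv.span B"
    using fv.maximal_independent_subset by blast
  have finB: "finite B" using B(1) fin finite_subset by blast
  let ?S = "inv_into UNIV M ` B"
  have MS: "M ` ?S = B" using B(1) by (auto simp: image_image f_inv_into_f subset_iff intro!: image_eqI)
  have "inj_on M ?S"
    using B(1) by (intro inj_onI) (auto simp: f_inv_into_f subset_iff)
  then have "fam_indep ?S M" using MS B finB by (simp add: fam_indep_iff)
  moreover have "card ?S = card B"
    using \<open>inj_on M ?S\<close> MS card_image by metis
  ultimately have "card B \<le> r" using le[of ?S] finB by auto
  then show ?thesis using B(3) finB by (intro rank_leI_span) auto
qed

lemma rank_le_submatrix:
  assumes "rank_le r M"
  shows "rank_le r (\<lambda>a b. if a \<in> R \<and> b \<in> C then M a b else 0)"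
proof -
  obtain u v where uv: "\<And>a b. M a b = (\<Sum>k<r. u k a * v k b)"
    using assms(1) unfolding rank_le_def by blast
  show ?thesis unfolding rank_le_def
    by (rule exI[of _ "\<lambda>k a. if a \<in> R then u k a else 0"], rule exI[of _ "\<lambda>k b. if b \<in> C then v k b else 0"])
       (auto simp: uv)
qed

lemma rank_le_0: "rank_le 0 M \<longleftrightarrow> M = 0"
  by (auto simp: rank_le_def fun_eq_iff)

text \<open>The only passage from the column rank of matrices to factorizations. \<open>rk\<close>
  is the size of a maximal independent set \<open>S\<close> of columns; the span of \<open>S\<close>
  yields a factorization, and conversely the independent columns in \<open>S\<close> bound the
  length of any factorization.\<close>

lemma rk_le_iff:
  fixes A :: "'a::field block"
  assumes A: "A \<in> blocks m n"
  shows "rk m n A \<le> r \<longleftrightarrow> rank_le r A"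
proof -
  interpret vec_space "TYPE('a)" m .
  let ?M = "mat m n (\<lambda>(a, b). A a b)"
  have M: "?M \<in> carrier_mat m n" by simp
  let ?P = "\<lambda>T. T \<subseteq> set (cols ?M) \<and> lin_indpt T"
  have indE: "lin_indpt {}" 
    by (metis M cols_dim empty_subsetI finite.emptyI lin_dep_def subset_empty all_not_in_conv subset_iff)
  obtain S where S: "maximal S ?P" "finite S"
    using maximal_exists_superset[of "set (cols ?M)" ?P "{}"] indE by auto
  have rk: "rk m n A = card S"
    unfolding rk_def using rank_card_indpt[OF M S(1)] .
  have Sc: "S \<subseteq> set (cols ?M)" "lin_indpt S" using S(1) by (auto simp: maximal_def)
  have colM: "set (cols ?M) \<subseteq> carrier_vec m" using cols_dim[of ?M] by simp
  \<comment> \<open>Column vectors of length \<open>m\<close> are extended by 0 to functions on all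
    naturals, to which \<open>fam_indep\<close> applies.\<close>
  let ?f = "\<lambda>v a. if a < m then v $ a else (0::'a)"
  have fcol: "?f (col ?M b) = btransp A b" if "b < n" for b
    using that A by (auto simp: fun_eq_iff blocks_def)
  have Sm: "S \<subseteq> carrier_vec m" using Sc colM by blast
  have famS: "fam_indep S ?f"
    unfolding fam_indep_def
  proof (intro allI impI ballI)
    fix c v assume c: "\<forall>x. (\<Sum>v\<in>S. c v * ?f v x) = 0" and v: "v \<in> S"
    have "lincomb c S = 0\<^sub>v m"
    proof (rule eq_vecI)
      fix i assume i: "i < dim_vec (0\<^sub>v m :: 'a Matrix.vec)"
      then have "lincomb c S $ i = (\<Sum>v\<in>S. c v * v $ i)"
        using lincomb_index[OF _ Sm] by auto
      also have "\<dots> = 0" using c[rule_format, of i] i by simp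
      finally show "lincomb c S $ i = 0\<^sub>v m $ i" using i by simp
    qed (use lincomb_dim[OF S(2) Sm] in auto)
    then show "c v = 0"
      using Sc(2) S(2) v unfolding lin_dep_def by (metis UNIV_I class_ring_simps(1) order_refl Pi_I)
  qed
  have inspan: "?f w \<in> fv.span (?f ` S)" if w: "w \<in> set (cols ?M)" for w
  proof -
    have "w \<in> span S"
    proof (rule ccontr)
      assume ns: "w \<notin> span S"
      then have "lin_indpt (insert w S)" "w \<notin> S"
        using Sc Sm colM w lin_dep_iff_in_span[of S w] span_mem[of S w] by auto
      then show False using S(1) Sc w unfolding maximal_def by blast
    qed
    then obtain c where c: "w = lincomb c S"
      using finite_in_span[OF S(2) Sm] by auto
    have "?f w = (\<Sum>v\<in>S. fv_scale (c v) (?f v))"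
      unfolding c by (auto simp: fun_eq_iff sum_fun_apply fv_scale_def lincomb_index[OF _ Sm])
    then show ?thesis
      by (simp add: fv.span_sum fv.span_scale fv.span_base)
  qed
  show ?thesis
  proof
    assume r: "rk m n A \<le> r"
    have "rank_le r (btransp A)"
    proof (rule rank_leI_span[of "?f ` S"])
      show "card (?f ` S) \<le> r" using r rk card_image_le[OF S(2)] order_trans by metis
      fix b show "btransp A b \<in> fv.span (?f ` S)"
      proof (cases "b < n")
        case True
        then have "col ?M b \<in> set (cols ?M)"
          by (metis M carrier_matD(2) cols_length cols_nth nth_mem)
        from inspan[OF this] show ?thesis by (simp only: fcol[OF True])
      next
        case False
        then have "btransp A b = 0" using A by (auto simp: blocks_def fun_eq_iff)
        then show ?thesis by (simp add: fv.span_zero)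
      qed
    qed (use S in auto)
    then show "rank_le r A" using rank_le_transp by blast
  next
    assume r: "rank_le r A"
    have "\<exists>b. b < n \<and> v = col ?M b" if "v \<in> S" for v
      using subsetD[OF Sc(1) that] by (auto simp: in_set_conv_nth)
    then obtain g where g: "\<And>v. v \<in> S \<Longrightarrow> g v < n \<and> v = col ?M (g v)" by metis
    have ginj: "inj_on g S" by (metis g inj_onI)
    have "fam_indep S (\<lambda>v. btransp A (g v))"
      using famS
    proof (rule iffD1[OF fam_indep_cong, rotated])
      fix v assume "v \<in> S"
      then have "g v < n" "v = col ?M (g v)" using g by blast+
      then show "?f v = btransp A (g v)" using fcol by metis
    qed
    then have "inj_on (\<lambda>v. btransp A (g v)) S" "fv.independent (btransp A ` g ` S)"
      by (auto simp: fam_indep_iff[OF S(2)] image_image)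
    then have "fam_indep (g ` S) (btransp A)"
      unfolding fam_indep_iff[OF finite_imageI[OF S(2)]] by (auto simp: inj_on_def)
    then have "card (g ` S) \<le> r" using rank_le_card_cols[OF r] S(2) by blast
    then show "rk m n A \<le> r" using rk ginj by (simp add: card_image)
  qed
qed

subsection \<open>Optimal anticodes of matrices\<close>

definition vecs :: "nat set \<Rightarrow> (nat \<Rightarrow> 'a::field) set" where
  "vecs C = {v. \<forall>b. b \<notin> C \<longrightarrow> v b = 0}"

definition rowmats :: "nat set \<Rightarrow> (nat \<Rightarrow> 'a::field) set \<Rightarrow> 'a block set" where
  "rowmats R \<Phi> = {M. (\<forall>a\<in>R. M a \<in> \<Phi>) \<and> (\<forall>a. a \<notin> R \<longrightarrow> M a = 0)}"

definition mats :: "nat set \<Rightarrow> nat set \<Rightarrow> 'a::field block set" where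
  "mats R C = {M. \<forall>a b. \<not> (a \<in> R \<and> b \<in> C) \<longrightarrow> M a b = 0}"

definition unit_row :: "nat \<Rightarrow> (nat \<Rightarrow> 'a::field) \<Rightarrow> 'a block" where
  "unit_row i \<phi> = (\<lambda>a. if a = i then \<phi> else 0)"

text \<open>The kernel of deleting row \<open>i\<close>, read as a space of vectors. Its nonzero
  members are the rank-one matrices available for clearing.\<close>

definition row_sec :: "nat \<Rightarrow> 'a::field block set \<Rightarrow> (nat \<Rightarrow> 'a) set" where
  "row_sec i V = {\<phi>. unit_row i \<phi> \<in> V}"

definition del_row :: "nat \<Rightarrow> 'a::field block set \<Rightarrow> 'a block set" where
  "del_row i V = (\<lambda>M. M(i := 0)) ` V"

lemma mats_eq_rowmats: "mats R C = rowmats R (vecs C)"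
  by (auto simp: mats_def rowmats_def vecs_def fun_eq_iff)

lemma card_vecs:
  assumes "finite C"
  shows "card (vecs C :: (nat \<Rightarrow> 'a::{finite,field}) set) = CARD('a) ^ card C"
  using card_functions_with_support[OF assms, of "\<lambda>_. UNIV :: 'a set"] by (simp add: vecs_def)

lemma finite_vecs: "finite C \<Longrightarrow> finite (vecs C :: (nat \<Rightarrow> 'a::{finite,field}) set)"
  using finite_functions_with_support[of C "\<lambda>_. UNIV :: 'a set"] by (simp add: vecs_def)

lemma card_rowmats: "finite R \<Longrightarrow> card (rowmats R \<Phi>) = card \<Phi> ^ card R"
  using card_functions_with_support[of R "\<lambda>_. \<Phi>"] by (simp add: rowmats_def)

lemma finite_rowmats: "finite R \<Longrightarrow> finite \<Phi> \<Longrightarrow> finite (rowmats R \<Phi>)"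
  using finite_functions_with_support[of R "\<lambda>_. \<Phi>"] by (simp add: rowmats_def)

lemma finite_mats: "finite R \<Longrightarrow> finite C \<Longrightarrow> finite (mats R C :: 'a::{finite,field} block set)"
  by (simp add: mats_eq_rowmats finite_rowmats finite_vecs)

lemma card_mats:
  "finite R \<Longrightarrow> finite C \<Longrightarrow> card (mats R C :: 'a::{finite,field} block set) = CARD('a) ^ (card R * card C)"
  by (simp add: mats_eq_rowmats card_rowmats card_vecs power_mult[symmetric] mult.commute)

lemma subspace_rowmats:
  assumes "fv.subspace \<Phi>" shows "block.subspace (rowmats R \<Phi>)"
proof -
  have "block_scale c M a = fv_scale c (M a)" for c :: 'a and M a
    by (simp add: block_scale_def fv_scale_def)
  then show ?thesis
    using assms unfolding block.subspace_def fv.subspace_def rowmats_def by auto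
qed

lemma transp_mats: "M \<in> mats R C \<Longrightarrow> btransp M \<in> mats C R"
  by (auto simp: mats_def)

lemma inj_transp: "inj_on (\<lambda>M. btransp M) V"
  by (auto simp: inj_on_def fun_eq_iff)

text \<open>Index sets instead of dimensions, so that a row or column can be deleted without
  renumbering the others. \<open>r\<close> is only an upper bound for the ranks, as deletion may
  lower them.\<close>

definition bspace :: "nat set \<Rightarrow> nat set \<Rightarrow> nat \<Rightarrow> 'a::field block set \<Rightarrow> bool" where
  "bspace R C r V \<longleftrightarrow> finite R \<and> finite C \<and> V \<subseteq> mats R C \<and> block.subspace V \<and> (\<forall>M\<in>V. rank_le r M)"

lemma bspace_finite: "bspace R C r (V :: 'a::{finite,field} block set) \<Longrightarrow> finite V"
  unfolding bspace_def using finite_mats finite_subset by blast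

lemma subspace_linear_image:
  assumes "block.subspace V" "\<And>M N. f (M + N) = f M + f N" "\<And>c M. f (block_scale c M) = block_scale c (f M)"
  shows "block.subspace (f ` V)"
proof -
  have "f 0 = 0" using assms(3)[of 0 0] by simp
  then have "0 \<in> f ` V" using block.subspace_0[OF assms(1)] by (metis imageI)
  moreover have "x + y \<in> f ` V" if "x \<in> f ` V" "y \<in> f ` V" for x y
    using that assms(2) block.subspace_add[OF assms(1)] by (metis (no_types, lifting) image_iff)
  moreover have "block_scale c x \<in> f ` V" if "x \<in> f ` V" for c x
    using that assms(3) block.subspace_scale[OF assms(1)] by (metis (no_types, lifting) image_iff)
  ultimately show ?thesis by (intro block.subspaceI)
qed

lemma bspace_transp:
  assumes "bspace R C r V" shows "bspace C R r ((\<lambda>M. btransp M) ` V)"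
proof -
  have "block.subspace ((\<lambda>M. btransp M) ` V)"
    by (rule subspace_linear_image) (use assms in \<open>auto simp: bspace_def block_scale_def fun_eq_iff\<close>)
  then show ?thesis
    using assms by (auto simp: bspace_def intro: rank_le_transp dest: transp_mats[OF subsetD])
qed

lemma card_transp_image: "card ((\<lambda>M. btransp M) ` V) = card V"
  by (rule card_image[OF inj_transp])

section \<open>Deleting rows and row sections\<close>

lemma bspace_del_row:
  assumes "bspace R C r V" shows "bspace (R - {i}) C r (del_row i V)"
proof -
  have "block.subspace (del_row i V)"
    unfolding del_row_def
    by (rule subspace_linear_image) (use assms in \<open>auto simp: bspace_def block_scale_def fun_eq_iff\<close>)
  moreover have "rank_le r (M(i := 0))" if "M \<in> V" for M
  proof -
    have eq: "M(i := 0) = (\<lambda>a b. if a \<in> - {i} \<and> b \<in> UNIV then M a b else 0)"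
      by (auto simp: fun_eq_iff)
    have "rank_le r M" using that assms by (simp add: bspace_def)
    then show ?thesis unfolding eq by (rule rank_le_submatrix)
  qed
  ultimately show ?thesis using assms by (auto simp: bspace_def del_row_def mats_def)
qed

lemma subspace_row_sec:
  fixes V :: "'a::field block set"
  assumes "block.subspace V" shows "fv.subspace (row_sec i V)"
proof -
  have "unit_row i (0 :: nat \<Rightarrow> 'a) = 0"
    "\<And>\<phi> \<psi> :: nat \<Rightarrow> 'a. unit_row i (\<phi> + \<psi>) = unit_row i \<phi> + unit_row i \<psi>"
    "\<And>(c :: 'a) \<phi>. unit_row i (fv_scale c \<phi>) = block_scale c (unit_row i \<phi>)"
    by (auto simp: unit_row_def fun_eq_iff block_scale_def fv_scale_def)
  then show ?thesis using assms unfolding fv.subspace_def block.subspace_def row_sec_def by auto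
qed

lemma row_sec_vecs:
  assumes "bspace R C r V" shows "row_sec i V \<subseteq> vecs C"
proof
  fix \<phi> assume "\<phi> \<in> row_sec i V"
  then have "unit_row i \<phi> \<in> mats R C" using assms by (auto simp: row_sec_def bspace_def)
  then have "\<And>b. b \<notin> C \<Longrightarrow> unit_row i \<phi> i b = 0" by (auto simp: mats_def)
  then show "\<phi> \<in> vecs C" by (simp add: unit_row_def vecs_def)
qed

lemma card_row_sec_del_row:
  fixes V :: "'a::{finite,field} block set"
  assumes "bspace R C r V"
  shows "card V = card (row_sec i V) * card (del_row i V)"
proof -
  have V: "block.subspace V" using assms by (simp add: bspace_def)
  have "card V = card {M\<in>V. M(i := 0) = 0} * card (del_row i V)"
    unfolding del_row_def
    by (rule card_kernel_image)
       (use bspace_finite[OF assms] V in \<open>auto simp: block.subspace_add block.subspace_diff\<close>)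
  also have "{M\<in>V. M(i := 0) = 0} = unit_row i ` row_sec i V"
  proof
    show "{M\<in>V. M(i := 0) = 0} \<subseteq> unit_row i ` row_sec i V"
    proof
      fix M assume M: "M \<in> {M\<in>V. M(i := 0) = 0}"
      then have "M a = 0" if "a \<noteq> i" for a using that by (auto dest: fun_cong[of _ _ a])
      then have "M = unit_row i (M i)" by (auto simp: unit_row_def)
      then show "M \<in> unit_row i ` row_sec i V" using M by (auto simp: row_sec_def)
    qed
  qed (auto simp: row_sec_def unit_row_def)
  also have "card (unit_row i ` row_sec i V) = card (row_sec i V)"
    by (rule card_image) (auto simp: inj_on_def unit_row_def fun_eq_iff)
  finally show ?thesis .
qed

text \<open>The sum of the matrices \<open>unit_row i (g i)\<close> belongs to \<open>V\<close> and
  has the independent vectors \<open>g i\<close> as its rows in \<open>S\<close>.\<close>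

lemma row_sec_family:
  assumes V: "bspace R C r V" and S: "finite S" "fam_indep S g" "\<And>i. i \<in> S \<Longrightarrow> g i \<in> row_sec i V"
  shows "card S \<le> r"
proof -
  let ?M = "\<Sum>i\<in>S. unit_row i (g i)"
  have "?M \<in> V"
    using V S by (intro block.subspace_sum) (auto simp: bspace_def row_sec_def)
  then have rk: "rank_le r ?M" using V by (simp add: bspace_def)
  have "?M a = g a" if "a \<in> S" for a
    using that S(1) by (simp add: sum_fun_apply unit_row_def)
  then have "fam_indep S ?M" using S(2) fam_indep_cong[of S ?M g] by blast
  then show ?thesis using rank_le_card_rows rk S(1) by blast
qed

lemma fam_indep_single: "v \<noteq> 0 \<Longrightarrow> fam_indep {i} (\<lambda>_. v)"
  by (simp add: fam_indep_iff)

lemma fam_indep_nonzero: "fam_indep S f \<Longrightarrow> finite S \<Longrightarrow> i \<in> S \<Longrightarrow> f i \<noteq> 0"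
  by (metis fam_indep_iff fv.dependent_zero image_eqI)

lemma span_fam_coeff:
  assumes "fam_indep S f" "finite S" "v \<in> fv.span (f ` S)"
  obtains d where "\<And>x. v x = (\<Sum>a\<in>S. d a * f a x)"
proof -
  have inj: "inj_on f S" using assms by (simp add: fam_indep_iff)
  obtain u where "v = (\<Sum>w\<in>f ` S. fv_scale (u w) w)"
    using assms(2,3) by (auto simp: fv.span_finite)
  then have "v x = (\<Sum>a\<in>S. u (f a) * f a x)" for x
    by (simp add: sum.reindex[OF inj] sum_fun_apply fv_scale_def)
  then show thesis by (rule that)
qed

text \<open>
  A rank-one matrix \<open>e_i \<otimes> \<phi>\<close> in \<open>V\<close> is used for clearing: after deleting row \<open>i\<close> and subtracting
  multiples of column \<open>j\<close>, where \<open>\<phi> j \<noteq> 0\<close>, the ranks drop by one, since otherwise adding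
  \<open>e_i \<otimes> \<phi>\<close> to some matrix of \<open>V\<close>, or not, would produce a rank that is too large.
\<close>

definition clear :: "nat \<Rightarrow> nat \<Rightarrow> (nat \<Rightarrow> 'a::field) \<Rightarrow> 'a block \<Rightarrow> 'a block" where
  "clear i j \<phi> M = (\<lambda>a b. if a = i then 0 else M a b - \<phi> b / \<phi> j * M a j)"

lemma rank_le_clear:
  fixes V :: "'a::{finite,field} block set"
  assumes V: "bspace R C r V" and \<phi>: "\<phi> \<in> row_sec i V" "\<phi> j \<noteq> 0" and M: "M \<in> V"
  shows "rank_le (r - 1) (clear i j \<phi> M)"
proof (rule rank_leI)
  let ?N = "clear i j \<phi> M"
  have "?N a = 0" if "a \<notin> R" for a
    using V M that by (auto simp: clear_def bspace_def mats_def fun_eq_iff)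
  then have "range ?N \<subseteq> insert 0 (?N ` R)" by auto
  then show "finite (range ?N)"
    using V finite_subset unfolding bspace_def by blast
  fix S assume S: "finite S" "fam_indep S ?N"
  have iS: "i \<notin> S" using fam_indep_nonzero[OF S(2,1), of i] by (auto simp: clear_def fun_eq_iff)
  have red: "(\<Sum>a\<in>S. c a * ?N a x) = (\<Sum>a\<in>S. c a * M a x) - \<phi> x / \<phi> j * (\<Sum>a\<in>S. c a * M a j)" for c x
  proof -
    have "(\<Sum>a\<in>S. c a * ?N a x) = (\<Sum>a\<in>S. c a * M a x - \<phi> x / \<phi> j * (c a * M a j))"
      by (rule sum.cong) (use iS in \<open>auto simp: clear_def algebra_simps\<close>)
    then show ?thesis by (simp add: sum_subtractf sum_distrib_left)
  qed
  have SM: "fam_indep S M"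
    unfolding fam_indep_def
  proof (intro allI impI)
    fix c assume "\<forall>x. (\<Sum>a\<in>S. c a * M a x) = 0"
    then have "(\<Sum>a\<in>S. c a * ?N a x) = 0" for x by (simp add: red)
    then show "\<forall>a\<in>S. c a = 0" using fam_indepD[OF S(2)] by blast
  qed
  \<comment> \<open>Clearing sends \<open>\<phi>\<close> itself to zero. Hence writing
    \<open>\<phi>\<close> in terms of the rows of \<open>M\<close> would give a relation between the
    cleared rows; its coefficients vanish, which contradicts
    \<open>\<phi> j \<noteq> 0\<close>.\<close>
  have \<phi>S: "\<phi> \<notin> fv.span (M ` S)"
  proof
    assume "\<phi> \<in> fv.span (M ` S)"
    then obtain d where d: "\<And>x. \<phi> x = (\<Sum>a\<in>S. d a * M a x)"
      using span_fam_coeff[OF SM S(1)] by blast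
    then have "(\<Sum>a\<in>S. d a * ?N a x) = 0" for x
      using \<phi>(2) by (simp add: red flip: d)
    then have "d a = 0" if "a \<in> S" for a using fam_indepD[OF S(2)] that by blast
    then have "\<phi> j = 0" using d by simp
    then show False using \<phi>(2) by simp
  qed
  have "\<exists>M'\<in>V. fam_indep (insert i S) M'"
  proof (cases "M i \<in> fv.span (M ` S)")
    case False
    then have "fam_indep (insert i S) (M(i := M i))" by (rule fam_indep_insert[OF SM S(1) iS])
    then show ?thesis using M by auto
  next
    case True
    then have "M i + \<phi> \<notin> fv.span (M ` S)"
      using \<phi>S by (metis fv.span_add_eq add.commute)
    then have "fam_indep (insert i S) (M(i := M i + \<phi>))" by (rule fam_indep_insert[OF SM S(1) iS])
    moreover have "M(i := M i + \<phi>) = M + unit_row i \<phi>"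
      by (auto simp: fun_eq_iff unit_row_def)
    moreover have "M + unit_row i \<phi> \<in> V"
      using M \<phi>(1) V by (intro block.subspace_add) (auto simp: bspace_def row_sec_def)
    ultimately show ?thesis by auto
  qed
  then obtain M' where "M' \<in> V" "fam_indep (insert i S) M'" ..
  then have "card (insert i S) \<le> r"
    using rank_le_card_rows[of r M' "insert i S"] V S(1) by (simp add: bspace_def)
  then show "card S \<le> r - 1" using iS S(1) by simp
qed

lemma bspace_clear:
  fixes V :: "'a::{finite,field} block set"
  assumes V: "bspace R C r V" and \<phi>: "\<phi> \<in> row_sec i V" "\<phi> j \<noteq> 0"
  shows "bspace (R - {i}) (C - {j}) (r - 1) (clear i j \<phi> ` V)"
proof -
  have "block.subspace (clear i j \<phi> ` V)"
    by (rule subspace_linear_image)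
       (use V in \<open>auto simp: bspace_def clear_def block_scale_def fun_eq_iff algebra_simps\<close>)
  moreover have "clear i j \<phi> M \<in> mats (R - {i}) (C - {j})" if "M \<in> V" for M
  proof -
    have "M \<in> mats R C" using V that by (auto simp: bspace_def)
    moreover have "\<phi> b = 0" if "b \<notin> C" for b
      using row_sec_vecs[OF V] \<phi> that by (auto simp: vecs_def)
    ultimately show ?thesis using \<phi>(2) by (auto simp: mats_def clear_def)
  qed
  ultimately show ?thesis
    using V rank_le_clear[OF assms] by (auto simp: bspace_def)
qed

text \<open>A matrix without row \<open>i\<close> that is cleared to zero is determined by its
  column \<open>j\<close>, since every other column is a multiple of that one. So the kernel of
  clearing has one free entry for each of the \<open>card R - 1\<close> remaining rows at
  most.\<close>

lemma card_del_row_le: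
  fixes V :: "'a::{finite,field} block set"
  assumes V: "bspace R C r V" and \<phi>: "\<phi> \<in> row_sec i V" "\<phi> j \<noteq> 0" and i: "i \<in> R"
  shows "card (del_row i V) \<le> CARD('a) ^ (card R - 1) * card (clear i j \<phi> ` V)"
proof -
  let ?D = "del_row i V"
  have D: "bspace (R - {i}) C r ?D" by (rule bspace_del_row[OF V])
  then have sD: "block.subspace ?D" by (simp add: bspace_def)
  have finD: "finite ?D" by (rule bspace_finite[OF D])
  have "card ?D = card {N\<in>?D. clear i j \<phi> N = 0} * card (clear i j \<phi> ` ?D)"
    by (rule card_kernel_image)
       (use finD sD in \<open>auto simp: block.subspace_add block.subspace_diff clear_def fun_eq_iff algebra_simps\<close>)
  moreover have "clear i j \<phi> ` ?D = clear i j \<phi> ` V"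
    by (auto simp: del_row_def image_image clear_def cong: image_cong if_cong)
  moreover have "card {N\<in>?D. clear i j \<phi> N = 0} \<le> card (vecs (R - {i}) :: (nat \<Rightarrow> 'a) set)"
  proof (rule card_inj_on_le)
    show "finite (vecs (R - {i}) :: (nat \<Rightarrow> 'a) set)"
      using V by (intro finite_vecs) (auto simp: bspace_def)
    show "(\<lambda>N a. N a j) ` {N\<in>?D. clear i j \<phi> N = 0} \<subseteq> vecs (R - {i})"
      using D by (auto simp: bspace_def mats_def vecs_def)
    show "inj_on (\<lambda>N a. N a j) {N\<in>?D. clear i j \<phi> N = 0}"
    proof (rule inj_onI)
      fix N N' assume N: "N \<in> {N\<in>?D. clear i j \<phi> N = 0}" "N' \<in> {N\<in>?D. clear i j \<phi> N = 0}"
        and e: "(\<lambda>a. N a j) = (\<lambda>a. N' a j)"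
      have *: "K a b = (if a = i then 0 else \<phi> b / \<phi> j * K a j)"
        if "K \<in> {N\<in>?D. clear i j \<phi> N = 0}" for K a b
      proof (cases "a = i")
        case True
        then show ?thesis using that by (auto simp: del_row_def)
      next
        case False
        have "clear i j \<phi> K a b = 0" using that by simp
        then show ?thesis using False by (simp add: clear_def)
      qed
      show "N = N'"
      proof (intro ext)
        fix a b
        show "N a b = N' a b"
          using *[OF N(1), of a b] *[OF N(2), of a b] fun_cong[OF e, of a] by simp
      qed
    qed
  qed
  moreover have "card (vecs (R - {i}) :: (nat \<Rightarrow> 'a) set) = CARD('a) ^ (card R - 1)"
    using V i by (subst card_vecs) (auto simp: bspace_def)
  ultimately show ?thesis by simp
qed

lemma row_sec_nonzero_rank_pos:
  assumes "bspace R C r V" "\<phi> \<in> row_sec i V" "\<phi> \<noteq> 0"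
  shows "0 < r" "i \<in> R"
proof -
  have u: "unit_row i \<phi> \<in> V" using assms by (simp add: row_sec_def)
  have "unit_row i \<phi> \<noteq> 0" using assms(3) by (auto simp: unit_row_def fun_eq_iff)
  moreover have "rank_le r (unit_row i \<phi>)" using assms(1) u by (simp add: bspace_def)
  ultimately show "0 < r" using rank_le_0 by (cases r) auto
  obtain b where "\<phi> b \<noteq> 0" using assms(3) by (auto simp: fun_eq_iff)
  then have "unit_row i \<phi> i b \<noteq> 0" by (simp add: unit_row_def)
  then show "i \<in> R" using u assms(1) by (auto simp: bspace_def mats_def)
qed

text \<open>The anticode bound for the cleared space is a hypothesis because the lemma is used
  twice: inside the induction that proves this bound, and afterwards to analyse equality.\<close>

lemma card_le_row_sec:
  fixes V :: "'a::{finite,field} block set"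
  assumes V: "bspace R C r V" and \<phi>: "\<phi> \<in> row_sec i V" "\<phi> \<noteq> 0" and RC: "card C \<le> card R"
    and bound: "\<And>j (W :: 'a block set). j \<in> C \<Longrightarrow> bspace (R - {i}) (C - {j}) (r - 1) W \<Longrightarrow>
      card W \<le> CARD('a) ^ ((card R - 1) * (r - 1))"
  shows "card V \<le> card (row_sec i V) * CARD('a) ^ ((card R - 1) * r)"
proof -
  note r = row_sec_nonzero_rank_pos[OF V \<phi>]
  obtain j where j: "\<phi> j \<noteq> 0" using \<phi>(2) by (auto simp: fun_eq_iff)
  then have jC: "j \<in> C" using row_sec_vecs[OF V] \<phi>(1) by (auto simp: vecs_def)
  have "card (del_row i V) \<le> CARD('a) ^ (card R - 1) * card (clear i j \<phi> ` V)"
    by (rule card_del_row_le[OF V \<phi>(1) j r(2)])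
  also have "\<dots> \<le> CARD('a) ^ (card R - 1) * CARD('a) ^ ((card R - 1) * (r - 1))"
    using bound[OF jC bspace_clear[OF V \<phi>(1) j]] by simp
  also have "\<dots> = CARD('a) ^ ((card R - 1) * r)"
    using r(1) by (cases r) (auto simp: power_add)
  finally show ?thesis by (simp add: card_row_sec_del_row[OF V, of i])
qed

section \<open>The anticode bound\<close>

lemma card_field_power_le_iff:
  "card (UNIV :: 'a::{finite,field} set) ^ a \<le> card (UNIV :: 'a set) ^ b \<longleftrightarrow> a \<le> b"
  using two_le_card_field[where 'a='a] by (intro power_increasing_iff) simp

lemma card_subspace_less_imp_le:
  fixes \<Phi> :: "(nat \<Rightarrow> 'a::{finite,field}) set"
  assumes "fv.subspace \<Phi>" "finite \<Phi>" "\<not> CARD('a) ^ Suc r \<le> card \<Phi>"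
  shows "card \<Phi> \<le> CARD('a) ^ r"
proof -
  have "card \<Phi> = CARD('a) ^ fv.dim \<Phi>" using fv.card_subspace_eq[OF assms(1,2)] by simp
  with assms(3) show ?thesis by (simp only: card_field_power_le_iff not_le less_Suc_eq_le)
qed

lemma finite_row_sec: "bspace R C r V \<Longrightarrow> finite (row_sec i (V :: 'a::{finite,field} block set))"
  using row_sec_vecs finite_vecs unfolding bspace_def by (metis bspace_def finite_subset)

text \<open>Some row section has at most q^r elements when \<open>r < card C\<close>: otherwise
  \<open>r + 1\<close> rows would admit independent representatives, against
  \<open>row_sec_family\<close>. If this section is nonzero, it allows clearing, which removes a
  row, a column and one from the rank bound. If it is zero, deleting the row loses nothing.\<close>

theorem anticode_bound:
  fixes V :: "'a::{finite,field} block set"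
  assumes "bspace R C r V" "card C \<le> card R"
  shows "card V \<le> CARD('a) ^ (card R * r)"
  using assms
proof (induction "card R + card C" arbitrary: R C r V rule: less_induct)
  case less
  note V = less.prems(1)
  have fin: "finite R" "finite C" and sub: "V \<subseteq> mats R C" and sV: "block.subspace V"
    using V by (auto simp: bspace_def)
  show ?case
  proof (cases "card C \<le> r")
    case True
    have "card V \<le> CARD('a) ^ (card R * card C)"
      using card_mono[OF finite_mats[OF fin] sub] card_mats[OF fin, where 'a='a] by simp
    also have "\<dots> \<le> CARD('a) ^ (card R * r)"
      using True by (simp only: card_field_power_le_iff) simp
    finally show ?thesis .
  next
    case False
    have "\<exists>i\<in>R. \<not> CARD('a) ^ Suc r \<le> card (row_sec i V)"
    proof (rule ccontr)
      assume large: "\<not> ?thesis"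
      obtain S where S: "S \<subseteq> R" "card S = Suc r" "finite S"
        using False less.prems(2) obtain_subset_with_card_n[of "Suc r" R] by auto
      obtain g where "\<forall>i\<in>S. g i \<in> row_sec i V" "fam_indep (S \<union> {}) g"
        using fam_indep_extend[of S "{}" "\<lambda>_. 0" "Suc r" "\<lambda>i. row_sec i V"] S large by auto
      then have "card S \<le> r" using row_sec_family[OF V S(3), of g] by simp
      then show False using S(2) by simp
    qed
    then obtain i where i: "i \<in> R" "\<not> CARD('a) ^ Suc r \<le> card (row_sec i V)" by blast
    have cR: "card (R - {i}) = card R - 1" "card R > 0" using i(1) fin card_gt_0_iff by auto
    show ?thesis
    proof (cases "\<exists>\<phi>\<in>row_sec i V. \<phi> \<noteq> 0")
      case True
      then obtain \<phi> where \<phi>: "\<phi> \<in> row_sec i V" "\<phi> \<noteq> 0" by blast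
      note r = row_sec_nonzero_rank_pos[OF V \<phi>]
      have "card V \<le> card (row_sec i V) * CARD('a) ^ ((card R - 1) * r)"
      proof (rule card_le_row_sec[OF V \<phi> less.prems(2)])
        fix j and W :: "'a block set"
        assume j: "j \<in> C" and W: "bspace (R - {i}) (C - {j}) (r - 1) W"
        have "card C > 0" using j fin card_gt_0_iff by blast
        then show "card W \<le> CARD('a) ^ ((card R - 1) * (r - 1))"
          using less.hyps[OF _ W] j fin cR less.prems(2) by simp
      qed
      also have "\<dots> \<le> CARD('a) ^ r * CARD('a) ^ ((card R - 1) * r)"
        using card_subspace_less_imp_le[OF subspace_row_sec[OF sV] finite_row_sec[OF V] i(2)]
        by simp
      also have "\<dots> = CARD('a) ^ (card R * r)"
        using cR by (cases "card R") (auto simp: power_add)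
      finally show ?thesis .
    next
      case False
      then have "row_sec i V = {0}"
        using fv.subspace_0[OF subspace_row_sec[OF sV]] by blast
      then have c: "card V = card (del_row i V)" using card_row_sec_del_row[OF V, of i] by simp
      note D = bspace_del_row[OF V, of i]
      show ?thesis
      proof (cases "card C < card R")
        case True
        then have "card (del_row i V) \<le> CARD('a) ^ ((card R - 1) * r)"
          using less.hyps[OF _ D] cR by simp
        also have "\<dots> \<le> CARD('a) ^ (card R * r)" by (simp only: card_field_power_le_iff) simp
        finally show ?thesis using c by simp
      next
        case False
        then have "card C = card R" using less.prems(2) by simp
        \<comment> \<open>Without row \<open>i\<close> a square format has more columns than rows.
          Transposing restores the hypothesis and makes \<open>card C = card R\<close> the number of
          rows, so the exponent stays the required one.\<close>
        then have "card ((\<lambda>M. btransp M) ` del_row i V) \<le> CARD('a) ^ (card C * r)"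
          using less.hyps[OF _ bspace_transp[OF D]] cR by simp
        then show ?thesis using c \<open>card C = card R\<close> by (simp add: card_transp_image)
      qed
    qed
  qed
qed

section \<open>The equality case of the anticode bound\<close>

definition row_type :: "nat \<Rightarrow> nat set \<Rightarrow> nat set \<Rightarrow> 'a::{finite,field} block set \<Rightarrow> bool" where
  "row_type r R C V \<longleftrightarrow>
     (\<exists>\<Phi>. fv.subspace \<Phi> \<and> \<Phi> \<subseteq> vecs C \<and> card \<Phi> = CARD('a) ^ r \<and> V = rowmats R \<Phi>)"

text \<open>Suppose \<open>\<phi>\<close> lies in section \<open>i\<close> but not in section
  \<open>j\<close>. As \<open>r < card R\<close>, there are \<open>r - 1\<close> rows besides these
  two, with representatives independent together with \<open>\<phi>\<close>. No vector of section
  \<open>j\<close> extends these \<open>r\<close> vectors, so it lies in their span; having at least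
  q^r elements it equals this span, which contains \<open>\<phi>\<close>.\<close>

lemma row_sec_subset:
  fixes V :: "'a::{finite,field} block set"
  assumes V: "bspace R C r V" and r: "r < card R"
    and large: "\<And>i. i \<in> R \<Longrightarrow> CARD('a) ^ r \<le> card (row_sec i V)"
    and ij: "i \<in> R" "j \<in> R"
  shows "row_sec i V \<subseteq> row_sec j V"
proof (rule ccontr)
  assume "\<not> ?thesis"
  then obtain \<phi> where \<phi>: "\<phi> \<in> row_sec i V" "\<phi> \<notin> row_sec j V" by blast
  have sV: "block.subspace V" and finR: "finite R" using V by (auto simp: bspace_def)
  have \<phi>0: "\<phi> \<noteq> 0" using \<phi>(2) fv.subspace_0[OF subspace_row_sec[OF sV]] by blast
  have r0: "0 < r" using row_sec_nonzero_rank_pos(1)[OF V \<phi>(1) \<phi>0] .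
  have "i \<noteq> j" using \<phi> by blast
  then have "card (R - {i, j}) = card R - 2"
    using ij by (subst card_Diff_subset) auto
  then have "r - 1 \<le> card (R - {i, j})" using r by simp
  then obtain S where S: "S \<subseteq> R - {i, j}" "card S = r - 1" "finite S"
    by (rule obtain_subset_with_card_n)
  have "\<exists>g. (\<forall>k. k \<notin> S \<longrightarrow> g k = \<phi>) \<and> (\<forall>k\<in>S. g k \<in> row_sec k V) \<and> fam_indep (S \<union> {i}) g"
    by (rule fam_indep_extend[of S "{i}" "\<lambda>_. \<phi>" r])
       (use S r0 large in \<open>auto simp: fam_indep_single[OF \<phi>0]\<close>)
  then obtain g where g: "\<And>k. k \<notin> S \<Longrightarrow> g k = \<phi>" "\<And>k. k \<in> S \<Longrightarrow> g k \<in> row_sec k V"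
    and ind: "fam_indep (S \<union> {i}) g" by blast
  let ?T = "S \<union> {i}"
  have "i \<notin> S" "j \<notin> S" using S(1) by auto
  then have T: "finite ?T" "card ?T = r" "j \<notin> ?T" using S(2,3) r0 \<open>i \<noteq> j\<close> by auto
  have gT: "g k \<in> row_sec k V" if "k \<in> ?T" for k using g that \<phi>(1) S(1) by auto
  have "row_sec j V \<subseteq> fv.span (g ` ?T)"
  proof
    fix \<psi> assume \<psi>: "\<psi> \<in> row_sec j V"
    show "\<psi> \<in> fv.span (g ` ?T)"
    proof (rule ccontr)
      assume "\<psi> \<notin> fv.span (g ` ?T)"
      then have "fam_indep (insert j ?T) (g(j := \<psi>))" by (rule fam_indep_insert[OF ind T(1,3)])
      then have "card (insert j ?T) \<le> r"
        by (rule row_sec_family[OF V, rotated]) (use T gT \<psi> in auto)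
      then show False using T by simp
    qed
  qed
  moreover note sp = card_span_fam[OF ind T(1)]
  ultimately have "row_sec j V = fv.span (g ` ?T)"
    using large[OF ij(2)] T(2) by (intro card_seteq) auto
  moreover have "\<phi> \<in> fv.span (g ` ?T)"
    using g(1)[of i] S(1) by (intro fv.span_base) auto
  ultimately show False using \<phi>(2) by simp
qed

text \<open>All row sections coincide with one space, and every matrix with rows in it is a sum of
  matrices \<open>unit_row j (M j)\<close> from \<open>V\<close>. The cardinality of
  \<open>V\<close> bounds this space from above and then leaves no room for further
  matrices.\<close>

lemma row_typeI:
  fixes V :: "'a::{finite,field} block set"
  assumes V: "bspace R C r V" and r: "r < card R"
    and large: "\<And>i. i \<in> R \<Longrightarrow> CARD('a) ^ r \<le> card (row_sec i V)"
    and card: "card V = CARD('a) ^ (card R * r)"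
  shows "row_type r R C V"
proof -
  have sV: "block.subspace V" and finR: "finite R" using V by (auto simp: bspace_def)
  obtain i where i: "i \<in> R" using r by fastforce
  let ?\<Phi> = "row_sec i V"
  have eq: "row_sec j V = ?\<Phi>" if "j \<in> R" for j
    using row_sec_subset[OF V r large i that] row_sec_subset[OF V r large that i] by blast
  have sub: "rowmats R ?\<Phi> \<subseteq> V"
  proof
    fix M assume M: "M \<in> rowmats R ?\<Phi>"
    have "M = (\<Sum>j\<in>R. unit_row j (M j))"
    proof
      fix a show "M a = (\<Sum>j\<in>R. unit_row j (M j)) a"
        using M finR by (cases "a \<in> R") (auto simp: sum_fun_apply unit_row_def rowmats_def)
    qed
    moreover have "unit_row j (M j) \<in> V" if "j \<in> R" for j
      using M eq[OF that] that by (auto simp: rowmats_def row_sec_def)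
    then have "(\<Sum>j\<in>R. unit_row j (M j)) \<in> V" by (rule block.subspace_sum[OF sV])
    ultimately show "M \<in> V" by simp
  qed
  have finV: "finite V" by (rule bspace_finite[OF V])
  have "card ?\<Phi> ^ card R \<le> (CARD('a) ^ r) ^ card R"
    using card_mono[OF finV sub] card_rowmats[OF finR, of ?\<Phi>] card
    by (simp add: power_mult[symmetric] mult.commute)
  then have "card ?\<Phi> \<le> CARD('a) ^ r"
    using r by (auto simp: power_mono_iff)
  then have c: "card ?\<Phi> = CARD('a) ^ r" using large[OF i] by simp
  then have "card (rowmats R ?\<Phi>) = card V"
    using card by (simp add: card_rowmats[OF finR] power_mult[symmetric] mult.commute)
  then have "V = rowmats R ?\<Phi>" using card_subset_eq[OF finV sub] by simp
  then show ?thesis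
    using subspace_row_sec[OF sV] row_sec_vecs[OF V] c unfolding row_type_def by blast
qed

text \<open>Clearing with \<open>\<phi>\<close> leaves at most q^((card R - 1) r) elements after row
  \<open>i\<close> is deleted, so equality in the bound forces a large section. Thus each row
  section is either zero or large, and the classification splits along this alternative.\<close>

lemma card_ge_row_sec:
  fixes V :: "'a::{finite,field} block set"
  assumes V: "bspace R C r V" and CR: "card C \<le> card R"
    and card: "card V = CARD('a) ^ (card R * r)"
    and \<phi>: "\<phi> \<in> row_sec i V" "\<phi> \<noteq> 0"
  shows "CARD('a) ^ r \<le> card (row_sec i V)"
proof -
  have iR: "i \<in> R" using row_sec_nonzero_rank_pos[OF V \<phi>] by simp
  have fin: "finite R" "finite C" using V by (auto simp: bspace_def)
  have cR: "card (R - {i}) = card R - 1" "card R > 0" using iR fin card_gt_0_iff by auto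
  have "card V \<le> card (row_sec i V) * CARD('a) ^ ((card R - 1) * r)"
  proof (rule card_le_row_sec[OF V \<phi> CR])
    fix j and W :: "'a block set"
    assume "j \<in> C" and W: "bspace (R - {i}) (C - {j}) (r - 1) W"
    then show "card W \<le> CARD('a) ^ ((card R - 1) * (r - 1))"
      using anticode_bound[OF W] fin cR CR by simp
  qed
  moreover have "card V = CARD('a) ^ r * CARD('a) ^ ((card R - 1) * r)"
    using cR card by (cases "card R") (auto simp: power_add)
  ultimately show ?thesis by simp
qed

text \<open>Counting makes \<open>V\<close> the space of all matrices. The case is treated apart
  because for square matrices it violates the condition \<open>r < card R\<close> of
  \<open>row_typeI\<close>.\<close>

lemma row_type_full:
  fixes V :: "'a::{finite,field} block set"
  assumes V: "bspace R C r V" and card: "card V = CARD('a) ^ (card R * card C)"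
  shows "row_type (card C) R C V"
proof -
  have fin: "finite R" "finite C" and sub: "V \<subseteq> mats R C" using V by (auto simp: bspace_def)
  have "V = rowmats R (vecs C)"
    using card_subset_eq[OF finite_mats[OF fin] sub] card card_mats[OF fin, where 'a='a]
    by (simp add: mats_eq_rowmats)
  moreover have "fv.subspace (vecs C :: (nat \<Rightarrow> 'a) set)"
    by (auto simp: fv.subspace_def vecs_def fv_scale_def)
  ultimately show ?thesis
    unfolding row_type_def using card_vecs[OF fin(2), where 'a='a] by blast
qed

text \<open>If a row section were zero, deleting the row would be injective and the result would
  exceed the anticode bound for \<open>card R - 1\<close> rows, unless \<open>r = 0\<close>. The
  bound applies there because \<open>card C < card R\<close> is strict.\<close>

lemma row_type_wide:
  fixes V :: "'a::{finite,field} block set"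
  assumes V: "bspace R C r V" and CR: "card C < card R" and r: "r \<le> card C"
    and card: "card V = CARD('a) ^ (card R * r)"
  shows "row_type r R C V"
proof (cases "r = card C")
  case True
  then show ?thesis using row_type_full[OF V] card by simp
next
  case False
  have sV: "block.subspace V" and fin: "finite R" using V by (auto simp: bspace_def)
  show ?thesis
  proof (rule row_typeI[OF V _ _ card])
    show "r < card R" using CR r by simp
    fix i assume i: "i \<in> R"
    show "CARD('a) ^ r \<le> card (row_sec i V)"
    proof (cases "\<exists>\<phi>\<in>row_sec i V. \<phi> \<noteq> 0")
      case True
      then show ?thesis using card_ge_row_sec[OF V _ card] CR by auto
    next
      case False
      then have z: "row_sec i V = {0}"
        using fv.subspace_0[OF subspace_row_sec[OF sV]] by blast
      have "CARD('a) ^ (card R * r) = card (del_row i V)"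
        using card_row_sec_del_row[OF V, of i] z card by simp
      also have "\<dots> \<le> CARD('a) ^ ((card R - 1) * r)"
        using anticode_bound[OF bspace_del_row[OF V, of i]] i fin CR by simp
      finally have "card R * r \<le> (card R - 1) * r" by (simp only: card_field_power_le_iff)
      then have "r = 0" using CR by (cases "card R") auto
      then show ?thesis using z by simp
    qed
  qed
qed

lemma fam_indep_add:
  assumes S: "finite S" "fam_indep S g" and jl: "j \<in> S" "l \<in> S" "j \<noteq> l"
  shows "fam_indep S (g(j := g j + g l))"
  unfolding fam_indep_def
proof (intro allI impI)
  fix c assume c: "\<forall>x. (\<Sum>b\<in>S. c b * (g(j := g j + g l)) b x) = 0"
  let ?c = "c(l := c l + c j)"
  have "(\<Sum>b\<in>S. ?c b * g b x) = 0" for x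
  proof -
    have "(\<Sum>b\<in>S. ?c b * g b x) = (\<Sum>b\<in>S. c b * g b x + (if b = l then c j * g l x else 0))"
      by (rule sum.cong) (auto simp: algebra_simps)
    also have "\<dots> = (\<Sum>b\<in>S. c b * g b x + (if b = j then c j * g l x else 0))"
      using S(1) jl by (simp add: sum.distrib)
    also have "\<dots> = (\<Sum>b\<in>S. c b * (g(j := g j + g l)) b x)"
      by (rule sum.cong) (auto simp: algebra_simps)
    finally show ?thesis using c by simp
  qed
  then have z: "?c b = 0" if "b \<in> S" for b using fam_indepD[OF S(2)] that by blast
  have "c j = 0" using z[OF jl(1)] jl(3) by simp
  moreover have "c b = 0" if "b \<in> S" "b \<noteq> l" for b using z[OF that(1)] that(2) by simp
  ultimately show "\<forall>b\<in>S. c b = 0" using z[OF jl(2)] by auto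
qed

text \<open>Column \<open>k\<close> is supported in row \<open>i\<close>, while the \<open>r\<close>
  columns in \<open>S\<close> are independent even without that row. A nonzero entry would make
  column \<open>k\<close> one more independent column.\<close>

lemma entry_zero_of_full_rank:
  fixes M :: "'a::field block"
  assumes rk: "rank_le r M" and S: "finite S" "card S = r" "k \<notin> S"
    and ind: "fam_indep S (\<lambda>b a. (M(i := 0)) a b)" and k: "\<And>a. a \<noteq> i \<Longrightarrow> M a k = 0"
  shows "M i k = 0"
proof (rule ccontr)
  assume Mik: "M i k \<noteq> 0"
  have "fam_indep (insert k S) (btransp M)"
    unfolding fam_indep_def
  proof (intro allI impI)
    fix c assume c: "\<forall>x. (\<Sum>b\<in>insert k S. c b * M x b) = 0"
    have "(\<Sum>b\<in>S. c b * (M(i := 0)) x b) = 0" for x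
    proof (cases "x = i")
      case False
      then show ?thesis using c[rule_format, of x] k[of x] S by simp
    qed simp
    then have z: "c b = 0" if "b \<in> S" for b using fam_indepD[OF ind] that by blast
    then have "c k * M i k = 0" using c[rule_format, of i] S by simp
    then show "\<forall>b\<in>insert k S. c b = 0" using z Mik by auto
  qed
  then have "card (insert k S) \<le> r" using rank_le_card_cols[OF rk] S(1) by blast
  then show False using S by simp
qed

text \<open>
  If no rank-one matrix of \<open>V\<close> is supported in row \<open>i\<close>, then deleting row \<open>i\<close> leaves all matrices
  with columns in a space \<open>Z\<close>. Lifting \<open>z \<otimes> e_j\<close> to \<open>M \<in> V\<close>, the entries of \<open>M\<close> in row \<open>i\<close> have to
  vanish outside column \<open>j\<close>: otherwise adding \<open>M\<close> to a suitable lift of rank \<open>r\<close> yields rank \<open>r + 1\<close>.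
\<close>

lemma column_rank_one:
  fixes V :: "'a::{finite,field} block set"
  assumes V: "bspace R C r V" and r: "0 < r" "r < card C" and j: "j \<in> C"
    and Z: "fv.subspace Z" "Z \<subseteq> vecs (R - {i})" "card Z = CARD('a) ^ r"
    and del: "(\<lambda>M. btransp M) ` del_row i V = rowmats C Z"
  shows "\<exists>w\<in>row_sec j ((\<lambda>M. btransp M) ` V). w \<noteq> 0"
proof -
  have sV: "block.subspace V" and fin: "finite C" and sub: "V \<subseteq> mats R C" using V by (auto simp: bspace_def)
  have lift: "\<exists>M\<in>V. btransp (M(i := 0)) = N" if "N \<in> rowmats C Z" for N
    using that unfolding del[symmetric] del_row_def by auto
  have rkV: "rank_le r M" if "M \<in> V" for M using V that by (simp add: bspace_def)
  have "CARD('a) ^ 1 \<le> card Z" 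
    using r unfolding Z(3) card_field_power_le_iff by simp
  then have "\<not> Z \<subseteq> {0}"
    using two_le_card_field[where 'a='a] card_mono[of "{0 :: nat \<Rightarrow> 'a}" Z] by auto
  then obtain z where z: "z \<in> Z" "z \<noteq> 0" by blast
  have "unit_row j z \<in> rowmats C Z"
    using z j fv.subspace_0[OF Z(1)] by (auto simp: rowmats_def unit_row_def)
  then obtain M where M: "M \<in> V" "btransp (M(i := 0)) = unit_row j z" using lift by blast
  have Mz: "M a b = (if b = j then z a else 0)" if "a \<noteq> i" for a b
    using fun_cong[OF fun_cong[OF M(2), of b], of a] that by (auto simp: unit_row_def)
  have zi: "z i = 0" using z(1) Z(2) by (auto simp: vecs_def)
  show ?thesis
  proof (cases "\<forall>k. k \<noteq> j \<longrightarrow> M i k = 0")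
    case True
    have "unit_row j (\<lambda>a. M a j) b a = M a b" for a b
      using True Mz[of a b] by (cases "a = i") (auto simp: unit_row_def)
    then have "unit_row j (\<lambda>a. M a j) = btransp M" by (intro ext)
    then have "(\<lambda>a. M a j) \<in> row_sec j ((\<lambda>M. btransp M) ` V)"
      using M(1) by (auto simp: row_sec_def)
    moreover obtain a where "z a \<noteq> 0" using z(2) by (auto simp: fun_eq_iff)
    then have "M a j \<noteq> 0" using Mz[of a j] zi by (cases "a = i") auto
    then have "(\<lambda>a. M a j) \<noteq> 0" by (auto simp: fun_eq_iff)
    ultimately show ?thesis by blast
  next
    case False
    then obtain k where k: "k \<noteq> j" "M i k \<noteq> 0" by blast
    then have kC: "k \<in> C" using M(1) sub by (auto simp: mats_def)
    have "card (C - {j, k}) = card C - 2"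
      using j kC k(1) by (subst card_Diff_subset) auto
    then have "r - 1 \<le> card (C - {j, k})" using r by simp
    then obtain S1 where S1: "S1 \<subseteq> C - {j, k}" "card S1 = r - 1" "finite S1"
      by (rule obtain_subset_with_card_n)
    define S where "S = insert j S1"
    have "j \<notin> S1" using S1(1) by auto
    then have S: "finite S" "card S = r" "k \<notin> S" "S \<subseteq> C" "j \<in> S"
      using S1 r k(1) j by (auto simp: S_def)
    have "M i k = 0"
    proof (cases "S1 = {}")
      \<comment> \<open>Here \<open>r = 1\<close>: without row \<open>i\<close> the matrix
        \<open>M\<close> already has \<open>r\<close> independent columns, so no second lift is
        needed.\<close>
      case True
      have "fam_indep S (unit_row j z)"
        using fam_indep_single[OF z(2), of j] fam_indep_cong[of "{j}" "unit_row j z" "\<lambda>_. z"] True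
        by (simp add: S_def unit_row_def)
      then have "fam_indep S (\<lambda>b a. (M(i := 0)) a b)" by (simp only: M(2))
      then show ?thesis
        by (rule entry_zero_of_full_rank[OF rkV[OF M(1)] S(1-3)]) (use Mz k(1) in auto)
    next
      case False
      then obtain l where l: "l \<in> S1" by blast
      then have lS: "l \<in> S" "l \<noteq> j" using S1 by (auto simp: S_def)
      \<comment> \<open>Prescribing \<open>g l = z\<close> makes \<open>N + M\<close>, away from row
        \<open>i\<close>, differ from \<open>N\<close> by the column operation replacing
        \<open>g j\<close> by \<open>g j + g l\<close>. So both have \<open>r\<close> independent
        columns there, both have entry 0 at \<open>i\<close>, \<open>k\<close>, and therefore so
        does their difference \<open>M\<close>.\<close>
      have "\<exists>g. (\<forall>b. b \<notin> S - {l} \<longrightarrow> g b = z) \<and> (\<forall>b\<in>S - {l}. g b \<in> Z) \<and> fam_indep (S - {l} \<union> {l}) g"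
        by (rule fam_indep_extend[of "S - {l}" "{l}" "\<lambda>_. z" r])
           (use S lS r Z(3) in \<open>auto simp: fam_indep_single[OF z(2)]\<close>)
      moreover have "S - {l} \<union> {l} = S" using lS by blast
      ultimately obtain g where g: "g l = z" "\<And>b. b \<in> S \<Longrightarrow> g b \<in> Z" "fam_indep S g"
        using z(1) by (metis Diff_iff insertCI)
      let ?N = "\<lambda>b. if b \<in> S then g b else 0"
      have "?N \<in> rowmats C Z"
        using g(2) S(4) fv.subspace_0[OF Z(1)] by (auto simp: rowmats_def)
      then obtain N where N: "N \<in> V" "btransp (N(i := 0)) = ?N" using lift by blast
      have Nz: "N a b = (if b \<in> S then g b a else 0)" if "a \<noteq> i" for a b
        using fun_cong[OF fun_cong[OF N(2), of b], of a] that by auto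
      have "fam_indep S ?N" using fam_indep_cong[of S ?N g] g(3) by simp
      then have "fam_indep S (\<lambda>b a. (N(i := 0)) a b)" by (simp only: N(2))
      then have 1: "N i k = 0"
        by (rule entry_zero_of_full_rank[OF rkV[OF N(1)] S(1-3)]) (use Nz S(3) in auto)
      have gi: "g b i = 0" if "b \<in> S" for b using g(2)[OF that] Z(2) by (auto simp: vecs_def)
      have "((N + M)(i := 0)) a b = (g(j := g j + g l)) b a" if "b \<in> S" for a b
        using that Nz[of a b] Mz[of a b] gi[OF that] gi[OF S(5)] gi[OF lS(1)] g(1) S(5)
        by (cases "a = i") auto
      then have "fam_indep S (\<lambda>b a. ((N + M)(i := 0)) a b)"
        using fam_indep_add[OF S(1) g(3) S(5) lS(1)] lS(2)
          fam_indep_cong[of S "\<lambda>b a. ((N + M)(i := 0)) a b" "g(j := g j + g l)"]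
        by (auto simp: fun_eq_iff)
      then have "(N + M) i k = 0"
        by (rule entry_zero_of_full_rank[OF rkV[OF block.subspace_add[OF sV N(1) M(1)]] S(1-3)])
           (use Nz Mz S(3) k(1) in auto)
      then show ?thesis using 1 by simp
    qed
    then show ?thesis using k(2) by simp
  qed
qed

text \<open>What remains is a square format with a zero row section. Deleting that row is injective,
  and the transposed result has more rows than columns, hence row type. By
  \<open>column_rank_one\<close> every row section of the transpose of \<open>V\<close> is then
  nonzero, so it is large and \<open>row_typeI\<close> applies.\<close>

theorem anticode_structure:
  fixes V :: "'a::{finite,field} block set"
  assumes V: "bspace R C r V" and CR: "card C \<le> card R" and r: "r \<le> card C"
    and card: "card V = CARD('a) ^ (card R * r)"
  shows "row_type r R C V \<or> card C = card R \<and> row_type r C R ((\<lambda>M. btransp M) ` V)"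
proof (cases "card C < card R \<or> r = card C \<or> (\<forall>i\<in>R. CARD('a) ^ r \<le> card (row_sec i V))")
  case True
  then show ?thesis
    using row_type_wide[OF V _ r card] row_type_full[OF V] card row_typeI[OF V _ _ card] CR r
    by (metis le_neq_implies_less less_le_trans)
next
  case False
  then have eq: "card C = card R" and rC: "r < card C" using CR r by auto
  obtain i where i: "i \<in> R" "\<not> CARD('a) ^ r \<le> card (row_sec i V)" using False by blast
  have sV: "block.subspace V" and fin: "finite R" using V by (auto simp: bspace_def)
  have z: "row_sec i V = {0}"
    using card_ge_row_sec[OF V CR card] i(2) fv.subspace_0[OF subspace_row_sec[OF sV]] by blast
  then have r0: "0 < r" using i(2) by (cases r) auto
  let ?W = "(\<lambda>M. btransp M) ` del_row i V"
  have "card ?W = CARD('a) ^ (card C * r)"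
    using card_row_sec_del_row[OF V, of i] z card eq by (simp add: card_transp_image)
  then have "row_type r C (R - {i}) ?W"
    using row_type_wide[OF bspace_transp[OF bspace_del_row[OF V, of i]]] rC eq i(1) fin by simp
  then obtain Z where Z: "fv.subspace Z" "Z \<subseteq> vecs (R - {i})" "card Z = CARD('a) ^ r" "?W = rowmats C Z"
    unfolding row_type_def by blast
  let ?T = "(\<lambda>M. btransp M) ` V"
  note T = bspace_transp[OF V]
  have cT: "card ?T = CARD('a) ^ (card C * r)" using card eq by (simp add: card_transp_image)
  have "row_type r C R ?T"
  proof (rule row_typeI[OF T rC _ cT])
    fix j assume "j \<in> C"
    from column_rank_one[OF V r0 rC this Z] obtain w where "w \<in> row_sec j ?T" "w \<noteq> 0" by blast
    then show "CARD('a) ^ r \<le> card (row_sec j ?T)"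
      using card_ge_row_sec[OF T _ cT] eq by simp
  qed
  then show ?thesis using eq by blast
qed

section \<open>Optimal anticodes of rank one less\<close>

lemma row_type_subspace:
  fixes V :: "'a::{finite,field} block set"
  assumes fin: "finite R" "finite C" and V: "row_type (Suc r) R C V"
  shows "\<exists>W\<subseteq>V. bspace R C r W \<and> card W = CARD('a) ^ (card R * r)"
proof -
  obtain \<Phi> where \<Phi>: "fv.subspace \<Phi>" "\<Phi> \<subseteq> vecs C" "card \<Phi> = CARD('a) ^ Suc r" "V = rowmats R \<Phi>"
    using V unfolding row_type_def by blast
  obtain B where B: "finite B" "fv.independent B" "card B = r" "fv.span B \<subseteq> \<Phi>"
      "card (fv.span B) = CARD('a) ^ r"
    using fv.subspace_contains_smaller_span[OF \<Phi>(1,3)] by auto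
  let ?W = "rowmats R (fv.span B)"
  have "rank_le r M" if "M \<in> ?W" for M
  proof (rule rank_leI_span[OF B(1)])
    fix a show "M a \<in> fv.span B"
      using that fv.span_zero by (cases "a \<in> R") (auto simp: rowmats_def)
  qed (simp add: B(3))
  moreover have "?W \<subseteq> V" using B(4) \<Phi>(4) by (auto simp: rowmats_def)
  moreover have "V \<subseteq> mats R C" using \<Phi>(2,4) by (auto simp: mats_eq_rowmats rowmats_def)
  moreover have "card ?W = CARD('a) ^ (card R * r)"
    using B(5) by (simp add: card_rowmats[OF fin(1)] power_mult[symmetric] mult.commute)
  ultimately show ?thesis
    using subspace_rowmats[OF fv.subspace_span] fin by (intro exI[of _ ?W]) (auto simp: bspace_def)
qed

theorem optimal_anticode_subspace:
  fixes V :: "'a::{finite,field} block set"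
  assumes V: "bspace R C (Suc r) V" and CR: "card C \<le> card R" and R: "0 < card R"
    and card: "card V = CARD('a) ^ (card R * Suc r)"
  shows "\<exists>W\<subseteq>V. bspace R C r W \<and> card W = CARD('a) ^ (card R * r)"
proof -
  have fin: "finite R" "finite C" and sub: "V \<subseteq> mats R C" using V by (auto simp: bspace_def)
  have "CARD('a) ^ (card R * Suc r) \<le> CARD('a) ^ (card R * card C)"
    using card_mono[OF finite_mats[OF fin] sub] card card_mats[OF fin, where 'a='a] by simp
  then have "card R * Suc r \<le> card R * card C" by (simp only: card_field_power_le_iff)
  then have "Suc r \<le> card C" using R by (simp only: mult_le_cancel1)
  from anticode_structure[OF V CR this card] show ?thesis
  proof
    assume "row_type (Suc r) R C V"
    then show ?thesis by (rule row_type_subspace[OF fin])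
  next
    assume T: "card C = card R \<and> row_type (Suc r) C R ((\<lambda>M. btransp M) ` V)"
    then obtain W where W: "W \<subseteq> (\<lambda>M. btransp M) ` V" "bspace C R r W" "card W = CARD('a) ^ (card C * r)"
      using row_type_subspace[OF fin(2,1)] by blast
    have "(\<lambda>M. btransp M) ` W \<subseteq> V" using W(1) by auto
    moreover have "card ((\<lambda>M. btransp M) ` W) = CARD('a) ^ (card R * r)"
      using W(3) T by (simp add: card_transp_image)
    ultimately show ?thesis using bspace_transp[OF W(2)] by blast
  qed
qed

subsection \<open>Weights of sum-rank metric codes\<close>

abbreviation max_rk :: "nat \<Rightarrow> nat \<Rightarrow> 'a::field block set \<Rightarrow> nat" where
  "max_rk m n \<A> \<equiv> Max (rk m n ` \<A>)"

lemma blocks_eq_mats: "blocks m n = mats {..<m} {..<n}"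
  by (simp add: blocks_def mats_def)

lemma finite_blocks: "finite (blocks m n :: 'a::{finite,field} block set)"
  by (simp add: blocks_eq_mats finite_mats)

lemma finite_blocks_subset: "\<A> \<subseteq> blocks m n \<Longrightarrow> finite (\<A> :: 'a::{finite,field} block set)"
  by (rule finite_subset[OF _ finite_blocks])

lemma card_field_power_inject:
  "card (UNIV :: 'a::{finite,field} set) ^ a = card (UNIV :: 'a set) ^ b \<longleftrightarrow> a = b"
  using two_le_card_field[where 'a='a] by (intro power_inject_exp) simp

lemma OAC_iff_card:
  fixes \<A> :: "'a::{finite,field} block set"
  shows "OAC m n \<A> \<longleftrightarrow>
    \<A> \<subseteq> blocks m n \<and> block.subspace \<A> \<and> card \<A> = CARD('a) ^ (m * max_rk m n \<A>)"
proof (cases "\<A> \<subseteq> blocks m n \<and> block.subspace \<A>")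
  case True
  then have "card \<A> = CARD('a) ^ block.dim \<A>"
    using block.card_subspace_eq[of \<A>] finite_blocks_subset by auto
  then show ?thesis using True by (simp add: OAC_def card_field_power_inject)
qed (auto simp: OAC_def)

lemma rk_le_width: "A \<in> blocks m w \<Longrightarrow> w \<le> n \<Longrightarrow> rk m n A \<le> w"
proof -
  assume A: "A \<in> blocks m w" and w: "w \<le> n"
  have "A a b = (\<Sum>k<w. A a k * (if k = b then 1 else 0))" for a b
  proof -
    have "(\<Sum>k<w. A a k * (if k = b then 1 else 0)) = (\<Sum>k<w. if k = b then A a k else 0)"
      by (rule sum.cong) auto
    then show ?thesis using A by (auto simp: blocks_def)
  qed
  then have "rank_le w A"
    unfolding rank_le_def
    by (intro exI[of _ "\<lambda>k a. A a k"] exI[of _ "\<lambda>k b. if k = b then 1 else 0"] allI)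
  moreover have "A \<in> blocks m n" using A w by (auto simp: blocks_def)
  ultimately show ?thesis by (simp add: rk_le_iff)
qed

lemma rk_le_max_rk:
  fixes \<A> :: "'a::{finite,field} block set"
  shows "\<A> \<subseteq> blocks m n \<Longrightarrow> A \<in> \<A> \<Longrightarrow> rk m n A \<le> max_rk m n \<A>"
  by (intro Max_ge finite_imageI imageI finite_blocks_subset)

lemma max_rk_attained:
  fixes \<A> :: "'a::{finite,field} block set"
  assumes "\<A> \<subseteq> blocks m n" "\<A> \<noteq> {}"
  obtains A where "A \<in> \<A>" "rk m n A = max_rk m n \<A>"
proof -
  have "max_rk m n \<A> \<in> rk m n ` \<A>"
    using assms finite_blocks_subset[OF assms(1)] by (intro Max_in) auto
  then show thesis using that by auto
qed

lemma OAC_nonempty: "OAC m n \<A> \<Longrightarrow> \<A> \<noteq> {}"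
  using block.subspace_0 by (auto simp: OAC_def)

lemma OAC_max_rk_le:
  fixes \<A> :: "'a::{finite,field} block set"
  assumes "OAC m n \<A>"
  shows "max_rk m n \<A> \<le> n"
proof -
  have "\<A> \<subseteq> blocks m n" using assms by (simp add: OAC_def)
  from max_rk_attained[OF this OAC_nonempty[OF assms]] obtain A
    where "A \<in> \<A>" "rk m n A = max_rk m n \<A>" .
  then show ?thesis using rk_le_width[of A m n n] \<open>\<A> \<subseteq> blocks m n\<close> by auto
qed

lemma bspace_of_max_rk:
  fixes \<A> :: "'a::{finite,field} block set"
  assumes "\<A> \<subseteq> blocks m n" "block.subspace \<A>"
  shows "bspace {..<m} {..<n} (max_rk m n \<A>) \<A>"
  using assms rk_le_max_rk[OF assms(1)] rk_le_iff
  unfolding bspace_def blocks_eq_mats[symmetric] by blast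

text \<open>The anticode bound forces the rank bound \<open>r\<close> to be attained: with a smaller
  maximal rank there would be too few matrices.\<close>

lemma OAC_of_bspace:
  fixes \<A> :: "'a::{finite,field} block set"
  assumes V: "bspace {..<m} {..<n} r \<A>" and card: "card \<A> = CARD('a) ^ (m * r)"
    and mn: "n \<le> m" "0 < m"
  shows "OAC m n \<A> \<and> max_rk m n \<A> = r"
proof -
  have \<A>: "\<A> \<subseteq> blocks m n" "block.subspace \<A>"
    using V by (auto simp: bspace_def blocks_eq_mats)
  then have "\<A> \<noteq> {}" using block.subspace_0 by blast
  with \<A>(1) obtain A where A: "A \<in> \<A>" "rk m n A = max_rk m n \<A>"
    by (rule max_rk_attained)
  then have "max_rk m n \<A> \<le> r"
    using V \<A>(1) rk_le_iff[of A m n r] by (auto simp: bspace_def)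
  moreover have "CARD('a) ^ (m * r) \<le> CARD('a) ^ (m * max_rk m n \<A>)"
    using anticode_bound[OF bspace_of_max_rk[OF \<A>]] mn card by simp
  then have "r \<le> max_rk m n \<A>" using mn by (simp only: card_field_power_le_iff mult_le_cancel1)
  ultimately have "max_rk m n \<A> = r" by simp
  then show ?thesis using \<A> card by (simp add: OAC_iff_card)
qed

lemma OAC_subset_pred:
  fixes \<A> :: "'a::{finite,field} block set"
  assumes "OAC m n \<A>" "max_rk m n \<A> = Suc r" "n \<le> m" "0 < m"
  shows "\<exists>\<B>\<subseteq>\<A>. OAC m n \<B> \<and> max_rk m n \<B> = r"
proof -
  have \<A>: "\<A> \<subseteq> blocks m n" "block.subspace \<A>" "card \<A> = CARD('a) ^ (m * Suc r)"
    using assms(1,2) by (auto simp: OAC_iff_card)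
  then have "bspace {..<m} {..<n} (Suc r) \<A>" using bspace_of_max_rk[OF \<A>(1,2)] assms(2) by simp
  from optimal_anticode_subspace[OF this] obtain \<B>
    where "\<B> \<subseteq> \<A>" "bspace {..<m} {..<n} r \<B>" "card \<B> = CARD('a) ^ (m * r)"
    using assms(3,4) \<A>(3) by auto
  then show ?thesis using OAC_of_bspace assms(3,4) by blast
qed

lemma card_blocks: "card (blocks m n :: 'a::{finite,field} block set) = CARD('a) ^ (m * n)"
  by (simp add: blocks_eq_mats card_mats)

lemma subspace_blocks: "block.subspace (blocks m n)"
  by (auto simp: block.subspace_def blocks_def block_scale_def)

lemma OAC_blocks:
  assumes "w \<le> n" "n \<le> m" "0 < m"
  shows "OAC m n (blocks m w :: 'a::{finite,field} block set)"
    and "max_rk m n (blocks m w :: 'a block set) = w"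
proof -
  have sub: "blocks m w \<subseteq> (blocks m n :: 'a block set)" using assms(1) by (auto simp: blocks_def)
  moreover have "rank_le w A" if "A \<in> blocks m w" for A :: "'a block"
    using rk_le_width[OF that assms(1)] rk_le_iff[of A m n w] sub that by blast
  ultimately have "bspace {..<m} {..<n} w (blocks m w :: 'a block set)"
    using subspace_blocks by (auto simp: bspace_def blocks_eq_mats)
  from OAC_of_bspace[OF this card_blocks assms(2,3)]
  show "OAC m n (blocks m w :: 'a block set)" "max_rk m n (blocks m w :: 'a block set) = w" by auto
qed

lemma rk_pos: "A \<in> blocks m n \<Longrightarrow> A \<noteq> 0 \<Longrightarrow> 0 < rk m n A"
  using rk_le_iff[of A m n 0] by (auto simp: rank_le_0)

text \<open>The multiplicative form of dim U + dim A \<le> dim(U \<inter> A) + dim P. Two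
  representations of the same sum differ by an element of \<open>U \<inter> A\<close>, so no fibre
  of addition on \<open>U \<times> A\<close> is larger than this intersection.\<close>

lemma card_Int_ge:
  fixes U A P :: "'b::ab_group_add set"
  assumes fin: "finite P" and sub: "U \<subseteq> P" "A \<subseteq> P" and P: "\<And>x y. x \<in> P \<Longrightarrow> y \<in> P \<Longrightarrow> x + y \<in> P"
    and U: "\<And>x y. x \<in> U \<Longrightarrow> y \<in> U \<Longrightarrow> x - y \<in> U"
    and A: "\<And>x y. x \<in> A \<Longrightarrow> y \<in> A \<Longrightarrow> x - y \<in> A"
  shows "card U * card A \<le> card (U \<inter> A) * card P"
proof -
  let ?f = "\<lambda>(u, a). u + a"
  have finUA: "finite U" "finite A" using fin sub finite_subset by auto
  have fibre: "card {x \<in> U \<times> A. ?f x = p} \<le> card (U \<inter> A)" if p: "p \<in> ?f ` (U \<times> A)" for p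
  proof -
    obtain u0 a0 where 0: "u0 \<in> U" "a0 \<in> A" "p = u0 + a0" using p by auto
    show ?thesis
    proof (rule card_inj_on_le)
      show "inj_on (\<lambda>x. fst x - u0) {x \<in> U \<times> A. ?f x = p}" by (auto simp: inj_on_def)
      show "(\<lambda>x. fst x - u0) ` {x \<in> U \<times> A. ?f x = p} \<subseteq> U \<inter> A"
      proof
        fix y assume "y \<in> (\<lambda>x. fst x - u0) ` {x \<in> U \<times> A. ?f x = p}"
        then obtain u a where ua: "u \<in> U" "a \<in> A" "u + a = u0 + a0" "y = u - u0"
          using 0 by auto
        then have "u = u0 + a0 - a" by (simp only: eq_diff_eq)
          then have "y = a0 - a" using ua(4) by simp
        then show "y \<in> U \<inter> A" using ua U[OF ua(1) 0(1)] A[OF 0(2) ua(2)] by auto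
      qed
    qed (use finUA in auto)
  qed
  have "card U * card A = card (U \<times> A)" by (simp add: card_cartesian_product)
  also have "\<dots> = (\<Sum>p\<in>?f ` (U \<times> A). card {x \<in> U \<times> A. ?f x = p})"
    using sum.image_gen[of "U \<times> A" "\<lambda>_. 1::nat" ?f] finUA by simp
  also have "\<dots> \<le> of_nat (card (?f ` (U \<times> A))) * card (U \<inter> A)"
    by (rule sum_bounded_above) (rule fibre)
  also have "\<dots> \<le> card P * card (U \<inter> A)"
  proof -
    have "?f ` (U \<times> A) \<subseteq> P" using sub P by auto
    then show ?thesis using card_mono[OF fin] by simp
  qed
  finally show ?thesis by (simp add: mult.commute)
qed

section \<open>Products of anticodes and attained minima\<close>

lemma card_prod_code: "card (prod_code t \<A>) = (\<Prod>i=1..t. card (\<A> i))"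
  using card_functions_with_support[of "{1..t}" \<A>] by (simp add: prod_code_def)

lemma finite_prod_code: "(\<And>i. i \<in> {1..t} \<Longrightarrow> finite (\<A> i)) \<Longrightarrow> finite (prod_code t \<A>)"
  using finite_functions_with_support[of "{1..t}" \<A>] by (simp add: prod_code_def)

lemma subspace_prod_code:
  assumes "\<And>i. i \<in> {1..t} \<Longrightarrow> block.subspace (\<A> i)"
  shows "cw.subspace (prod_code t \<A>)"
proof -
  have "cw_scale c C i = block_scale c (C i)" for c :: 'a and C i
    by (simp add: cw_scale_def block_scale_def)
  then show ?thesis
    using assms by (auto simp: cw.subspace_def block.subspace_def prod_code_def)
qed

lemma prod_code_mono:
  assumes "\<And>i. i \<in> {1..t} \<Longrightarrow> \<A> i \<subseteq> \<B> i"
  shows "prod_code t \<A> \<subseteq> prod_code t \<B>"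
  unfolding prod_code_def using assms by blast

lemma finite_ambient: "finite (ambient t m n :: 'a::{finite,field} codeword set)"
  unfolding ambient_def by (rule finite_prod_code) (rule finite_blocks)

lemma subspace_ambient: "cw.subspace (ambient t m n)"
  unfolding ambient_def by (rule subspace_prod_code) (rule subspace_blocks)

lemma card_cw:
  fixes V :: "'a::{finite,field} codeword set"
  assumes "cw.subspace V" "V \<subseteq> ambient t m n"
  shows "card V = CARD('a) ^ cw.dim V"
  using cw.card_subspace_eq[OF assms(1)] finite_subset[OF assms(2) finite_ambient] by simp

text \<open>The maxima of the blocks are attained by one codeword, since in a product the blocks are
  chosen independently.\<close>

lemma maxsrk_prod_code:
  fixes \<A> :: "nat \<Rightarrow> 'a::{finite,field} block set"
  assumes \<A>: "\<And>i. i \<in> {1..t} \<Longrightarrow> \<A> i \<subseteq> blocks (m i) (n i) \<and> \<A> i \<noteq> {}"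
  shows "maxsrk t m n (prod_code t \<A>) = (\<Sum>i=1..t. max_rk (m i) (n i) (\<A> i))"
  unfolding maxsrk_def
proof (rule Max_eqI)
  show "finite (srk t m n ` prod_code t \<A>)"
    using \<A> by (intro finite_imageI finite_prod_code) (auto intro: finite_blocks_subset)
next
  fix s assume "s \<in> srk t m n ` prod_code t \<A>"
  then obtain C where C: "C \<in> prod_code t \<A>" "s = srk t m n C" by blast
  have "rk (m i) (n i) (C i) \<le> max_rk (m i) (n i) (\<A> i)" if "i \<in> {1..t}" for i
    using \<A>[OF that] C(1) that by (intro rk_le_max_rk) (auto simp: prod_code_def)
  then show "s \<le> (\<Sum>i=1..t. max_rk (m i) (n i) (\<A> i))"
    unfolding C(2) srk_def by (rule sum_mono)
next
  have "\<exists>A\<in>\<A> i. rk (m i) (n i) A = max_rk (m i) (n i) (\<A> i)" if "i \<in> {1..t}" for i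
    using \<A>[OF that] max_rk_attained[of "\<A> i" "m i" "n i"] by blast
  then obtain M where M: "\<And>i. i \<in> {1..t} \<Longrightarrow> M i \<in> \<A> i \<and> rk (m i) (n i) (M i) = max_rk (m i) (n i) (\<A> i)"
    by metis
  let ?C = "\<lambda>i. if i \<in> {1..t} then M i else 0"
  have C: "?C \<in> prod_code t \<A>" using M by (auto simp: prod_code_def)
  have eq: "srk t m n ?C = (\<Sum>i=1..t. max_rk (m i) (n i) (\<A> i))"
    unfolding srk_def by (rule sum.cong) (use M in auto)
  show "(\<Sum>i=1..t. max_rk (m i) (n i) (\<A> i)) \<in> srk t m n ` prod_code t \<A>"
    unfolding eq[symmetric] using C by (rule imageI)
qed

lemma maxsrk_OAC:
  fixes \<A> :: "nat \<Rightarrow> 'a::{finite,field} block set"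
  assumes "\<forall>i\<in>{1..t}. OAC (m i) (n i) (\<A> i)"
  shows "maxsrk t m n (prod_code t \<A>) = (\<Sum>i=1..t. max_rk (m i) (n i) (\<A> i))"
proof (rule maxsrk_prod_code)
  fix i assume "i \<in> {1..t}"
  then have "OAC (m i) (n i) (\<A> i)" using assms by blast
  then show "\<A> i \<subseteq> blocks (m i) (n i) \<and> \<A> i \<noteq> {}" using OAC_nonempty unfolding OAC_def by blast
qed

lemma wt_le:
  fixes \<A> :: "nat \<Rightarrow> 'a::{finite,field} block set"
  assumes "\<forall>i\<in>{1..t}. OAC (m i) (n i) (\<A> i)" "\<C> \<subseteq> prod_code t \<A>"
  shows "wt t m n \<C> \<le> (\<Sum>i=1..t. max_rk (m i) (n i) (\<A> i))"
  unfolding wt_def maxsrk_OAC[OF assms(1), symmetric] by (rule wellorder_Inf_le1) (use assms in blast)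

lemma srk_prod_code_le:
  fixes \<A> :: "nat \<Rightarrow> 'a::{finite,field} block set"
  assumes "\<forall>i\<in>{1..t}. OAC (m i) (n i) (\<A> i)" "C \<in> prod_code t \<A>"
  shows "srk t m n C \<le> (\<Sum>i=1..t. max_rk (m i) (n i) (\<A> i))"
  unfolding srk_def by (rule sum_mono, rule rk_le_max_rk) (use assms in \<open>auto simp: OAC_def prod_code_def\<close>)

lemma gen_weight_le:
  "subcode \<U> \<C> \<Longrightarrow> r \<le> cw.dim \<U> \<Longrightarrow> gen_weight t m n \<C> r \<le> wt t m n \<U>"
  unfolding gen_weight_def by (rule wellorder_Inf_le1) blast

lemma gen_weight_attained:
  assumes "cw.subspace \<C>" "r \<le> cw.dim \<C>"
  obtains \<U> where "subcode \<U> \<C>" "r \<le> cw.dim \<U>" "wt t m n \<U> = gen_weight t m n \<C> r"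
proof -
  have "gen_weight t m n \<C> r \<in> {wt t m n \<U> | \<U>. subcode \<U> \<C> \<and> r \<le> cw.dim \<U>}"
    unfolding gen_weight_def using assms by (intro Inf_nat_def1) (auto simp: subcode_def)
  then show thesis using that by auto
qed

lemma gen_weight_mono:
  assumes "cw.subspace \<C>" "r \<le> s" "s \<le> cw.dim \<C>"
  shows "gen_weight t m n \<C> r \<le> gen_weight t m n \<C> s"
proof -
  obtain \<U> where "subcode \<U> \<C>" "s \<le> cw.dim \<U>" "wt t m n \<U> = gen_weight t m n \<C> s"
    using gen_weight_attained[OF assms(1,3)] .
  then show ?thesis using gen_weight_le[of \<U> \<C> r t m n] assms(2) by simp
qed

lemma admissible_subseq:
  assumes "admissible_seq t m n ds" "subseq es ds"
  shows "admissible_seq t m n es"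
proof -
  obtain I where I: "es = nths ds I" using assms(2) by (auto simp: subseq_conv_nths)
  have "count_list es x \<le> count_list ds x" for x
    using list_emb_length[of "(=)" "filter ((=) x) es" "filter ((=) x) ds"] assms(2)
    by (simp add: count_list_eq_length_filter)
  moreover have "sorted es" "set es \<subseteq> set ds"
    using assms(1) unfolding I admissible_seq_def by (auto simp: sorted_nths dest: in_set_nthsD)
  ultimately show ?thesis using assms(1) unfolding admissible_seq_def by (meson order_trans)
qed

section \<open>Necessity: range and multiplicities of the weights\<close>

locale sum_rank_space =
  fixes t :: nat and m n :: "nat \<Rightarrow> nat"
  assumes n_pos: "\<And>i. i \<in> {1..t} \<Longrightarrow> 0 < n i"
    and m_ge_n: "\<And>i. i \<in> {1..t} \<Longrightarrow> n i \<le> m i"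
    and m_decr: "\<And>i j. 1 \<le> i \<Longrightarrow> i \<le> j \<Longrightarrow> j \<le> t \<Longrightarrow> m j \<le> m i"
begin

lemma m_pos: "i \<in> {1..t} \<Longrightarrow> 0 < m i"
  using n_pos m_ge_n by (meson less_le_trans)

lemma OAC_ambient: "\<forall>i\<in>{1..t}. OAC (m i) (n i) (blocks (m i) (n i) :: 'a::{finite,field} block set)"
  by (intro ballI OAC_blocks(1) order_refl m_ge_n m_pos)

text \<open>\<open>Inf\<close> picks an element only of a nonempty set. The full blocks provide one,
  being optimal anticodes because \<open>n i \<le> m i\<close>.\<close>

lemma wt_attained:
  fixes \<C> :: "'a::{finite,field} codeword set"
  assumes "\<C> \<subseteq> ambient t m n"
  obtains \<A> where "\<forall>i\<in>{1..t}. OAC (m i) (n i) (\<A> i)" "\<C> \<subseteq> prod_code t \<A>"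
    "wt t m n \<C> = (\<Sum>i=1..t. max_rk (m i) (n i) (\<A> i))"
proof -
  have "wt t m n \<C> \<in> {maxsrk t m n (prod_code t \<A>) | \<A>.
      (\<forall>i\<in>{1..t}. OAC (m i) (n i) (\<A> i)) \<and> \<C> \<subseteq> prod_code t \<A>}"
    unfolding wt_def
    by (rule Inf_nat_def1) (use assms OAC_ambient[where 'a='a] in \<open>auto simp: ambient_def\<close>)
  then obtain \<A> where \<A>: "\<forall>i\<in>{1..t}. OAC (m i) (n i) (\<A> i)" "\<C> \<subseteq> prod_code t \<A>"
    "wt t m n \<C> = maxsrk t m n (prod_code t \<A>)" by blast
  then show thesis by (intro that[of \<A>]) (simp_all only: maxsrk_OAC[OF \<A>(1)])
qed

lemma wt_ambient_le:
  fixes \<C> :: "'a::{finite,field} codeword set"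
  assumes "\<C> \<subseteq> ambient t m n"
  shows "wt t m n \<C> \<le> (\<Sum>i=1..t. n i)"
proof -
  have "wt t m n \<C> \<le> (\<Sum>i=1..t. max_rk (m i) (n i) (blocks (m i) (n i) :: 'a block set))"
    by (rule wt_le[OF OAC_ambient]) (use assms in \<open>simp add: ambient_def\<close>)
  also have "\<dots> = (\<Sum>i=1..t. n i)"
    by (rule sum.cong) (simp_all add: OAC_blocks(2) m_ge_n m_pos)
  finally show ?thesis .
qed

lemma wt_pos:
  fixes \<C> :: "'a::{finite,field} codeword set"
  assumes "\<C> \<subseteq> ambient t m n" "C \<in> \<C>" "C \<noteq> 0"
  shows "0 < wt t m n \<C>"
proof -
  obtain \<A> where \<A>: "\<forall>i\<in>{1..t}. OAC (m i) (n i) (\<A> i)" "\<C> \<subseteq> prod_code t \<A>"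
    "wt t m n \<C> = (\<Sum>i=1..t. max_rk (m i) (n i) (\<A> i))"
    using wt_attained[OF assms(1)] .
  obtain i where i: "C i \<noteq> 0" using assms(3) by (auto simp: fun_eq_iff)
  have C: "C \<in> ambient t m n" using assms by blast
  then have it: "i \<in> {1..t}" using i by (auto simp: ambient_def prod_code_def)
  then have "0 < rk (m i) (n i) (C i)"
    using C i by (intro rk_pos) (auto simp: ambient_def prod_code_def)
  also have "\<dots> \<le> srk t m n C"
    unfolding srk_def using it by (intro member_le_sum) auto
  also have "\<dots> \<le> wt t m n \<C>"
    unfolding \<A>(3) using srk_prod_code_le[OF \<A>(1)] \<A>(2) assms(2) by blast
  finally show ?thesis .
qed

text \<open>The blocks before \<open>i\<close> have total rank at most
  \<open>\<Sum>l=1..<i. n l\<close> and cannot carry the whole weight, which gives the factor to be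
  shrunk. The new product has index q^(m l) in the old one, and so has its intersection with
  \<open>\<U>\<close> at most. Only here does the order of the \<open>m i\<close> matter.\<close>

lemma gen_weight_drop:
  fixes \<U> :: "'a::{finite,field} codeword set"
  assumes C: "is_code t m n \<C>" and U: "subcode \<U> \<C>" and dim: "r + m i \<le> cw.dim \<U>"
    and i: "i \<in> {1..t}" and wt: "(\<Sum>l=1..<i. n l) < wt t m n \<U>"
  shows "gen_weight t m n \<C> r < wt t m n \<U>"
proof -
  have Usub: "\<U> \<subseteq> ambient t m n" "cw.subspace \<U>"
    using C U by (auto simp: is_code_def subcode_def)
  obtain \<A> where \<A>: "\<forall>i\<in>{1..t}. OAC (m i) (n i) (\<A> i)" "\<U> \<subseteq> prod_code t \<A>"
    "wt t m n \<U> = (\<Sum>i=1..t. max_rk (m i) (n i) (\<A> i))"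
    using wt_attained[OF Usub(1)] .
  have "\<exists>l\<in>{i..t}. 0 < max_rk (m l) (n l) (\<A> l)"
  proof (rule ccontr)
    assume "\<not> ?thesis"
    then have "wt t m n \<U> = (\<Sum>l=1..<i. max_rk (m l) (n l) (\<A> l))"
      unfolding \<A>(3) using i by (intro sum.mono_neutral_right) auto
    also have "\<dots> \<le> (\<Sum>l=1..<i. n l)"
      using \<A>(1) i by (intro sum_mono OAC_max_rk_le) auto
    finally show False using wt by simp
  qed
  then obtain l where l: "l \<in> {i..t}" "0 < max_rk (m l) (n l) (\<A> l)" ..
  then have lt: "l \<in> {1..t}" using i by simp
  obtain \<rho> where \<rho>: "max_rk (m l) (n l) (\<A> l) = Suc \<rho>"
    using gr0_implies_Suc[OF l(2)] ..
  have "OAC (m l) (n l) (\<A> l)" using \<A>(1) lt by blast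
  from OAC_subset_pred[OF this \<rho> m_ge_n[OF lt] m_pos[OF lt]] obtain \<B>
    where \<B>: "\<B> \<subseteq> \<A> l" "OAC (m l) (n l) \<B>" "max_rk (m l) (n l) \<B> = \<rho>" by blast
  let ?\<A> = "\<A>(l := \<B>)"
  have \<A>': "\<forall>i\<in>{1..t}. OAC (m i) (n i) (?\<A> i)" using \<A>(1) \<B>(2) by simp
  let ?P = "prod_code t \<A>" and ?P' = "prod_code t ?\<A>"
  have sP: "cw.subspace ?P" "cw.subspace ?P'"
    using \<A>(1) \<A>' by (auto intro!: subspace_prod_code simp: OAC_def)
  have P'P: "?P' \<subseteq> ?P" by (rule prod_code_mono) (use \<B>(1) in auto)
  have PA: "?P \<subseteq> ambient t m n"
    unfolding ambient_def by (rule prod_code_mono) (use \<A>(1) in \<open>auto simp: OAC_def\<close>)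
  have finP: "finite ?P" using finite_subset[OF PA finite_ambient] .
  have rest: "(\<Prod>i\<in>{1..t} - {l}. card (?\<A> i)) = (\<Prod>i\<in>{1..t} - {l}. card (\<A> i))"
    by (rule prod.cong) auto
  have "card (\<A> l) = CARD('a) ^ m l * card \<B>"
    using \<A>(1) \<B>(2,3) lt \<rho> by (auto simp: OAC_iff_card power_add)
  then have cP: "card ?P = CARD('a) ^ m l * card ?P'"
    unfolding card_prod_code prod.remove[OF finite_atLeastAtMost lt] rest by simp
  have "0 < card ?P'"
    using cw.subspace_0[OF sP(2)] finite_subset[OF P'P finP] card_gt_0_iff by blast
  moreover have "card \<U> * card ?P' \<le> card (\<U> \<inter> ?P') * card ?P"
    using cw.subspace_diff Usub(2) sP cw.subspace_add
    by (intro card_Int_ge[OF finP \<A>(2) P'P]) blast+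
  ultimately have "card \<U> \<le> card (\<U> \<inter> ?P') * CARD('a) ^ m l"
    unfolding cP by simp
  moreover have sU: "cw.subspace (\<U> \<inter> ?P')"
    using Usub(2) sP(2) by (rule cw.subspace_inter)
  moreover have "card (\<U> \<inter> ?P') = CARD('a) ^ cw.dim (\<U> \<inter> ?P')"
    by (rule card_cw[OF sU, of t m n]) (use Usub(1) in blast)
  ultimately have "CARD('a) ^ cw.dim \<U> \<le> CARD('a) ^ (cw.dim (\<U> \<inter> ?P') + m l)"
    using card_cw[OF Usub(2,1)] by (simp add: power_add)
  then have "cw.dim \<U> \<le> cw.dim (\<U> \<inter> ?P') + m l" by (simp only: card_field_power_le_iff)
  moreover have "m l \<le> m i" using m_decr[of i l] l(1) i by simp
  ultimately have "r \<le> cw.dim (\<U> \<inter> ?P')" using dim by simp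
  moreover have "subcode (\<U> \<inter> ?P') \<C>" using U sU by (auto simp: subcode_def)
  ultimately have "gen_weight t m n \<C> r \<le> wt t m n (\<U> \<inter> ?P')" by (intro gen_weight_le)
  also have "\<dots> \<le> (\<Sum>i=1..t. max_rk (m i) (n i) (?\<A> i))" by (rule wt_le[OF \<A>']) blast
  also have "\<dots> < wt t m n \<U>"
    unfolding \<A>(3) by (rule sum_strict_mono_ex1) (use \<B>(3) \<rho> lt in auto)
  finally show ?thesis .
qed

lemma admissible_gen_weights:
  fixes \<C> :: "'a::{finite,field} codeword set"
  assumes C: "is_code t m n \<C>"
  shows "admissible_seq t m n (gen_weights t m n \<C>)"
proof -
  let ?k = "cw.dim \<C>" and ?f = "gen_weight t m n \<C>"
  have sC: "cw.subspace \<C>" "\<C> \<subseteq> ambient t m n" using C by (auto simp: is_code_def)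
  have srt: "sorted (gen_weights t m n \<C>)"
    unfolding gen_weights_def sorted_iff_nth_mono
    using gen_weight_mono[OF sC(1)] by (auto simp del: upt_Suc)
  have rng: "?f r \<in> {1..\<Sum>i=1..t. n i}" if r: "r \<in> {1..?k}" for r
  proof -
    have "r \<le> ?k" using r by simp
    from gen_weight_attained[OF sC(1) this] obtain \<U>
      where U: "subcode \<U> \<C>" "r \<le> cw.dim \<U>" "wt t m n \<U> = ?f r" by blast
    have Ua: "\<U> \<subseteq> ambient t m n" using U(1) sC(2) by (auto simp: subcode_def)
    have "\<not> \<U> \<subseteq> {0}"
    proof
      assume "\<U> \<subseteq> {0}"
      then have "cw.dim \<U> \<le> 0" using cw.dim_le_card[of \<U> "{}"] by simp
      then show False using U(2) r by simp
    qed
    then show ?thesis using wt_pos[OF Ua] wt_ambient_le[OF Ua] U(3) by fastforce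
  qed
  have "count_list (gen_weights t m n \<C>) ((\<Sum>l=1..<i. n l) + j) \<le> m i"
    if i: "i \<in> {1..t}" and j: "j \<in> {1..n i}" for i j
  proof (rule ccontr)
    let ?h = "(\<Sum>l=1..<i. n l) + j"
    let ?S = "{r \<in> {1..?k}. ?f r = ?h}"
    assume "\<not> ?thesis"
    moreover have "count_list (gen_weights t m n \<C>) ?h = length (filter (\<lambda>r. ?h = ?f r) [1..<Suc ?k])"
      by (simp add: gen_weights_def count_list_eq_length_filter filter_map o_def del: upt_Suc)
    moreover have "\<dots> = card ?S"
      by (subst distinct_length_filter) (auto intro!: arg_cong[where f = card])
    ultimately have S: "m i < card ?S" by simp
    then have ne: "?S \<noteq> {}" by (metis card.empty not_less0)
    \<comment> \<open>More than \<open>m i\<close> indices fit into this interval, so its ends are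
      at least \<open>m i\<close> apart. A subcode attaining the weight at \<open>Max ?S\<close>
      then has enough dimensions to force a smaller weight at \<open>Min ?S\<close>.\<close>
    have "?S \<subseteq> {Min ?S..Max ?S}" by auto
    from card_mono[OF _ this] have "card ?S \<le> Suc (Max ?S) - Min ?S" by simp
    then have le: "Min ?S + m i \<le> Max ?S" using S by simp
    have "Max ?S \<in> ?S" "Min ?S \<in> ?S" using ne by (auto intro!: Max_in Min_in simp del: mem_Collect_eq)
    then have Mx: "Max ?S \<le> ?k" "?f (Max ?S) = ?h" and Mn: "?f (Min ?S) = ?h" by auto
    from gen_weight_attained[OF sC(1) Mx(1), of t m n] obtain \<U>
      where U: "subcode \<U> \<C>" "Max ?S \<le> cw.dim \<U>" "wt t m n \<U> = ?h"
      unfolding Mx(2) .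
    have "?f (Min ?S) < wt t m n \<U>"
      by (rule gen_weight_drop[OF C U(1) _ i]) (use U le j in auto)
    then show False using U(3) Mn by simp
  qed
  then show ?thesis
    using srt rng unfolding admissible_seq_def by (auto simp: gen_weights_def simp del: upt_Suc)
qed

end

subsection \<open>Codes with prescribed generalized weights\<close>

text \<open>Blocks are filled with \<open>h\<close> columns from the left. Truncated subtraction
  gives each block what the previous ones leave over, and 0 once \<open>h\<close> is used
  up.\<close>

lemma sum_min_prefix:
  fixes n :: "nat \<Rightarrow> nat"
  shows "(\<Sum>i=1..k. min (n i) (h - (\<Sum>l=1..<i. n l))) = min h (\<Sum>i=1..k. n i)"
proof (induction k)
  case (Suc k)
  have "(\<Sum>l=1..<Suc k. n l) = (\<Sum>l=1..k. n l)" by (simp only: atLeastLessThanSuc_atLeastAtMost)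
  then show ?case using Suc.IH by simp
qed simp

lemma blocks_mono: "w \<le> w' \<Longrightarrow> blocks m w \<subseteq> blocks m w'"
  by (auto simp: blocks_def)

context sum_rank_space
begin

definition width :: "nat \<Rightarrow> nat \<Rightarrow> nat" where
  "width h i = min (n i) (h - (\<Sum>l=1..<i. n l))"

text \<open>The codewords supported in the first \<open>h\<close> of the \<open>n 1 + \<dots> + n t\<close> columns.\<close>

definition corner :: "nat \<Rightarrow> 'a::{finite,field} codeword set" where
  "corner h = prod_code t (\<lambda>i. blocks (m i) (width h i))"

lemma sum_width: "h \<le> (\<Sum>i=1..t. n i) \<Longrightarrow> (\<Sum>i=1..t. width h i) = h"
  unfolding width_def sum_min_prefix by simp

lemma width_le: "width h i \<le> n i"
  by (simp add: width_def)

lemma OAC_corner: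
  "\<forall>i\<in>{1..t}. OAC (m i) (n i) (blocks (m i) (width h i) :: 'a::{finite,field} block set)"
  by (intro ballI OAC_blocks(1) width_le m_ge_n m_pos)

lemma sum_max_rk_corner:
  assumes "h \<le> (\<Sum>i=1..t. n i)"
  shows "(\<Sum>i=1..t. max_rk (m i) (n i) (blocks (m i) (width h i) :: 'a::{finite,field} block set)) = h"
proof -
  have "(\<Sum>i=1..t. max_rk (m i) (n i) (blocks (m i) (width h i) :: 'a block set)) = (\<Sum>i=1..t. width h i)"
    by (rule sum.cong) (simp_all add: OAC_blocks(2) width_le m_ge_n m_pos)
  then show ?thesis using sum_width[OF assms] by simp
qed

lemma wt_corner_le:
  fixes \<U> :: "'a::{finite,field} codeword set"
  shows "h \<le> (\<Sum>i=1..t. n i) \<Longrightarrow> \<U> \<subseteq> corner h \<Longrightarrow> wt t m n \<U> \<le> h"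
  using wt_le[OF OAC_corner[where 'a='a], of \<U> h] sum_max_rk_corner[where 'a='a, of h]
  by (simp add: corner_def)

lemma srk_corner_le:
  fixes C :: "'a::{finite,field} codeword"
  shows "h \<le> (\<Sum>i=1..t. n i) \<Longrightarrow> C \<in> corner h \<Longrightarrow> srk t m n C \<le> h"
  using srk_prod_code_le[OF OAC_corner[where 'a='a], of C h] sum_max_rk_corner[where 'a='a, of h]
  by (simp add: corner_def)

lemma width_mono: "h \<le> h' \<Longrightarrow> width h i \<le> width h' i"
  unfolding width_def by linarith

lemma corner_mono: "h \<le> h' \<Longrightarrow> corner h \<subseteq> corner h'"
  unfolding corner_def by (intro prod_code_mono blocks_mono width_mono)

lemma corner_ambient: "corner h \<subseteq> ambient t m n"
  unfolding corner_def ambient_def by (intro prod_code_mono blocks_mono width_le)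

lemma subspace_corner: "cw.subspace (corner h)"
  unfolding corner_def by (rule subspace_prod_code) (rule subspace_blocks)

lemma sum_split:
  assumes "j \<in> {1..t}"
  shows "(\<Sum>i=1..t. f i) = (\<Sum>i=1..<j. f i) + (\<Sum>i=j..t. f i :: nat)"
    and "(\<Sum>i=j..t. f i) = f j + (\<Sum>i=Suc j..t. f i :: nat)"
  using assms sum.atLeastLessThan_concat[of 1 j "Suc t" f]
  by (simp_all add: atLeastLessThanSuc_atLeastAtMost sum.atLeast_Suc_atMost)

text \<open>For \<open>h\<close> in the form of an MSRD distance, the blocks before \<open>j\<close>
  are full, block \<open>j\<close> has \<open>Suc \<delta>\<close> columns and the later ones none.
  The sum is the dimension of \<open>corner h\<close>, in a shape comparable with that of
  \<open>D h\<close>.\<close>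

lemma sum_width_weighted:
  assumes j: "j \<in> {1..t}" and \<delta>: "Suc \<delta> \<le> n j" and h: "h = (\<Sum>l=1..<j. n l) + \<delta> + 1"
  shows "(\<Sum>i=1..t. m i * width h i) = (\<Sum>i=1..<j. m i * n i) + m j * Suc \<delta>"
proof -
  have step: "(\<Sum>l=1..<i. n l) + n i \<le> (\<Sum>l=1..<k. n l)" if "1 \<le> i" "i < k" for i k
  proof -
    have "(\<Sum>l=1..<i. n l) + n i = (\<Sum>l=1..<Suc i. n l)" using that by simp
    also have "\<dots> \<le> (\<Sum>l=1..<k. n l)" using that by (intro sum_mono2) auto
    finally show ?thesis .
  qed
  have "(\<Sum>i=1..<j. m i * width h i) = (\<Sum>i=1..<j. m i * n i)"
  proof (rule sum.cong)
    fix i assume "i \<in> {1..<j}"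
    then show "m i * width h i = m i * n i" using step[of i j] h by (simp add: width_def)
  qed simp
  moreover have "width h j = Suc \<delta>" using \<delta> h by (simp add: width_def)
  moreover have "(\<Sum>i=Suc j..t. m i * width h i) = 0"
  proof (rule sum.neutral, rule ballI)
    fix i assume "i \<in> {Suc j..t}"
    then show "m i * width h i = 0" using step[of j i] h \<delta> j by (simp add: width_def)
  qed
  ultimately show ?thesis
    using sum_split[OF j, of "\<lambda>i. m i * width h i"] by simp
qed

lemma card_corner:
  "card (corner h :: 'a::{finite,field} codeword set) = CARD('a) ^ (\<Sum>i=1..t. m i * width h i)"
  by (simp add: corner_def card_prod_code card_blocks power_sum)

lemma card_ambient:
  "card (ambient t m n :: 'a::{finite,field} codeword set) = CARD('a) ^ (\<Sum>i=1..t. m i * n i)"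
  by (simp add: ambient_def card_prod_code card_blocks power_sum)

end

section \<open>Sufficiency: independent vectors of prescribed level\<close>

locale MSRD_chain = sum_rank_space t m n for t m n +
  fixes D :: "nat \<Rightarrow> 'a::{finite,field} codeword set"
  assumes D_chain: "\<And>h. 1 \<le> h \<Longrightarrow> h < (\<Sum>i = 1..t. n i) \<Longrightarrow> D (Suc h) \<subseteq> D h"
    and D_MSRD: "\<And>h. h \<in> {1..\<Sum>i = 1..t. n i} \<Longrightarrow> MSRD t m n (D h) \<and> min_dist t m n (D h) = h"
begin

lemma D_antimono:
  assumes "1 \<le> h" "h \<le> h'" "h' \<le> (\<Sum>i = 1..t. n i)"
  shows "D h' \<subseteq> D h"
  using assms(2,3)
proof (induction h' rule: dec_induct)
  case (step k)
  then show ?case using D_chain[of k] assms(1) by force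
qed simp

lemma D_code:
  assumes "h \<in> {1..\<Sum>i = 1..t. n i}"
  shows "D h \<subseteq> ambient t m n" "cw.subspace (D h)"
  using D_MSRD[OF assms] by (auto simp: MSRD_def is_code_def)

lemma D_srk:
  assumes "h \<in> {1..\<Sum>i = 1..t. n i}" "C \<in> D h" "C \<noteq> 0"
  shows "h \<le> srk t m n C"
proof -
  have "min_dist t m n (D h) \<le> srk t m n C"
    unfolding min_dist_def by (rule wellorder_Inf_le1) (use assms in auto)
  then show ?thesis using D_MSRD[OF assms(1)] by simp
qed

text \<open>
  The codewords of \<open>level h\<close> have weight \<open>h\<close>: they lie in an optimal anticode of rank \<open>h\<close> and in a
  code of minimum distance \<open>h\<close>. By a dimension count there are enough of them.
\<close>

definition level :: "nat \<Rightarrow> 'a codeword set" where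
  "level h = D h \<inter> corner h"

text \<open>The block \<open>j\<close> comes from the MSRD parameters of \<open>D h\<close>. Writing
  \<open>h\<close> as the length of the earlier blocks plus an offset matches
  \<open>admissible_seq\<close>, so the same \<open>m j\<close> bounds the level from below and the
  multiplicity of \<open>h\<close> from above.\<close>

lemma card_level:
  assumes h: "h \<in> {1..\<Sum>i = 1..t. n i}"
  obtains j where "j \<in> {1..t}" "h - (\<Sum>l=1..<j. n l) \<in> {1..n j}"
    "h = (\<Sum>l=1..<j. n l) + (h - (\<Sum>l=1..<j. n l))" "CARD('a) ^ m j \<le> card (level h)"
proof -
  obtain j \<delta> where j: "j \<in> {1..t}" and \<delta>: "\<delta> \<le> n j - 1" and hd: "h = (\<Sum>i = 1..<j. n i) + \<delta> + 1"
    and dimD: "cw.dim (D h) = (\<Sum>i = j..t. m i * n i) - \<delta> * m j"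
    using D_MSRD[OF h] unfolding MSRD_def by auto
  have \<delta>': "Suc \<delta> \<le> n j" using \<delta> n_pos[OF j] by simp
  let ?A = "\<Sum>i=1..<j. m i * n i" and ?B = "\<Sum>i=j..t. m i * n i"
  have cD: "card (D h) = CARD('a) ^ (?B - \<delta> * m j)"
    using card_cw[OF D_code(2,1)[OF h]] dimD by simp
  have cA: "card (ambient t m n :: 'a codeword set) = CARD('a) ^ (?A + ?B)"
    unfolding card_ambient using sum_split(1)[OF j, of "\<lambda>i. m i * n i"] by simp
  have cc: "card (corner h :: 'a codeword set) = CARD('a) ^ (?A + m j * Suc \<delta>)"
    unfolding card_corner sum_width_weighted[OF j \<delta>' hd] ..
  have sL: "cw.subspace (level h)"
    unfolding level_def using D_code(2)[OF h] subspace_corner by (rule cw.subspace_inter)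
  have cL: "card (level h) = CARD('a) ^ cw.dim (level h)"
    by (rule card_cw[OF sL, of t m n]) (use D_code(1)[OF h] in \<open>auto simp: level_def\<close>)
  have "card (D h) * card (corner h :: 'a codeword set) \<le> card (level h) * card (ambient t m n :: 'a codeword set)"
    unfolding level_def
    by (rule card_Int_ge[OF finite_ambient D_code(1)[OF h] corner_ambient])
       (auto intro: cw.subspace_add[OF subspace_ambient] cw.subspace_diff[OF D_code(2)[OF h]]
         cw.subspace_diff[OF subspace_corner])
  then have "CARD('a) ^ ((?B - \<delta> * m j) + (?A + m j * Suc \<delta>)) \<le> CARD('a) ^ (cw.dim (level h) + (?A + ?B))"
    unfolding cD cA cc cL by (simp only: power_add)
  then have "(?B - \<delta> * m j) + (?A + m j * Suc \<delta>) \<le> cw.dim (level h) + (?A + ?B)"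
    by (simp only: card_field_power_le_iff)
  \<comment> \<open>Truncation is harmless: \<open>?B - \<delta> * m j\<close> and
    \<open>\<delta> * m j\<close> add up to at least \<open>?B\<close>, and one more
    \<open>m j\<close> is left over.\<close>
  then have "m j \<le> cw.dim (level h)" by (simp add: mult.commute)
  then have "CARD('a) ^ m j \<le> card (level h)" unfolding cL by (simp only: card_field_power_le_iff)
  then show thesis using that[of j] j hd \<delta>' by simp
qed

lemma D_srk_less_imp_zero:
  assumes h: "h \<in> {1..\<Sum>i = 1..t. n i}" and C: "C \<in> D h" "srk t m n C < h"
  shows "C = 0"
  using D_srk[OF h C(1)] C(2) by (metis not_le)

text \<open>The new vector has to avoid the span of all earlier ones. Those of the same level
  \<open>d\<close> are fewer than \<open>m j\<close>, so their span cannot contain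
  \<open>level d\<close>. Those of smaller level span a part of \<open>corner (d - 1)\<close>, where
  ranks are below \<open>d\<close>, so this span meets \<open>D d\<close> only in 0.\<close>

lemma level_list:
  assumes "admissible_seq t m n ds"
  shows "\<exists>vs. length vs = length ds \<and> distinct vs \<and> cw.independent (set vs) \<and>
    (\<forall>r<length ds. vs ! r \<in> level (ds ! r))"
  using assms
proof (induction ds rule: rev_induct)
  case Nil
  then show ?case by (simp add: cw.independent_empty)
next
  case (snoc d ds)
  let ?N = "\<Sum>i = 1..t. n i"
  have "subseq ds (ds @ [d])" by (rule list_emb_prefix) simp
  with snoc.prems have "admissible_seq t m n ds" by (rule admissible_subseq)
  then obtain vs where vs: "length vs = length ds" "distinct vs" "cw.independent (set vs)"
    "\<And>r. r < length ds \<Longrightarrow> vs ! r \<in> level (ds ! r)" using snoc.IH by blast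
  have dN: "d \<in> {1..?N}" and dsN: "set ds \<subseteq> {1..?N}" and le: "\<And>e. e \<in> set ds \<Longrightarrow> e \<le> d"
    using snoc.prems by (auto simp: admissible_seq_def sorted_append)
  obtain j where j: "j \<in> {1..t}" "d - (\<Sum>l=1..<j. n l) \<in> {1..n j}"
    "d = (\<Sum>l=1..<j. n l) + (d - (\<Sum>l=1..<j. n l))" "CARD('a) ^ m j \<le> card (level d)"
    using card_level[OF dN] .
  have "count_list (ds @ [d]) d \<le> m j"
    using snoc.prems j(1,2) unfolding admissible_seq_def by (subst (2) j(3)) blast
  then have cnt: "count_list ds d < m j" by simp
  let ?T = "(!) vs ` {r. r < length ds \<and> ds ! r = d}" and ?T' = "(!) vs ` {r. r < length ds \<and> ds ! r < d}"
  have setvs: "set vs = ?T \<union> ?T'"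
  proof -
    have "set vs = (!) vs ` {r. r < length ds}"
      using vs(1) by (auto simp: set_conv_nth)
    also have "{r. r < length ds} = {r. r < length ds \<and> ds ! r = d} \<union> {r. r < length ds \<and> ds ! r < d}"
      using le[OF nth_mem] by (auto simp: le_less)
    finally show ?thesis by (simp only: image_Un)
  qed
  have "card ?T \<le> card {r. r < length ds \<and> ds ! r = d}" by (rule card_image_le) simp
  also have "\<dots> = count_list ds d"
    by (simp add: count_list_eq_length_filter length_filter_conv_card eq_commute)
  finally have cT: "card ?T < m j" using cnt by simp
  have "cw.independent ?T" using vs(3) setvs cw.independent_mono by blast
  then have sp: "finite (cw.span ?T)" "card (cw.span ?T) = CARD('a) ^ card ?T"
    using cw.card_span_independent[of ?T] by auto
  have "CARD('a) ^ card ?T < CARD('a) ^ m j"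
    using cT two_le_card_field[where 'a='a] by (intro power_strict_increasing) auto
  then have "\<not> level d \<subseteq> cw.span ?T"
    using card_mono[OF sp(1), of "level d"] sp(2) j(4) by auto
  then obtain v where v: "v \<in> level d" "v \<notin> cw.span ?T" by blast
  have vD: "v \<in> D d" using v(1) by (simp add: level_def)
  have "?T \<subseteq> D d" using vs(4) by (auto simp: level_def)
  then have TD: "cw.span ?T \<subseteq> D d" using D_code(2)[OF dN] by (rule cw.span_minimal)
  have "?T' \<subseteq> corner (d - 1)"
  proof
    fix x assume "x \<in> ?T'"
    then obtain r where "r < length ds" "ds ! r < d" "x = vs ! r" by blast
    then have "x \<in> corner (ds ! r)" "ds ! r \<le> d - 1" using vs(4)[of r] by (auto simp: level_def)
    then show "x \<in> corner (d - 1)" using corner_mono by blast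
  qed
  then have TA: "cw.span ?T' \<subseteq> corner (d - 1)" using subspace_corner by (rule cw.span_minimal)
  have vn: "v \<notin> cw.span (set vs)"
  proof
    assume "v \<in> cw.span (set vs)"
    then obtain x y where xy: "v = x + y" "x \<in> cw.span ?T" "y \<in> cw.span ?T'"
      unfolding setvs cw.span_Un by blast
    \<comment> \<open>Both \<open>v\<close> and the part \<open>x\<close> of level \<open>d\<close>
      lie in \<open>D d\<close>, hence so does the remainder \<open>y\<close> from the smaller
      levels, whose rank is too small for a nonzero word of \<open>D d\<close>.\<close>
    have "v - x \<in> D d" using vD TD xy(2) cw.subspace_diff[OF D_code(2)[OF dN]] by blast
    then have "y \<in> D d" using xy(1) by simp
    moreover have "srk t m n y \<le> d - 1" using srk_corner_le[of "d - 1" y] TA xy(3) dN by auto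
    ultimately have "y = 0" using D_srk_less_imp_zero[OF dN, of y] dN by auto
    then show False using v(2) xy by simp
  qed
  then have "v \<notin> set vs" using cw.span_base by blast
  moreover have "cw.independent (insert v (set vs))"
    using vn vs(3) by (rule cw.independent_insertI)
  ultimately show ?case
    using vs v(1) by (intro exI[of _ "vs @ [v]"]) (auto simp: nth_append less_Suc_eq)
qed

theorem code_with_gen_weights:
  assumes ds: "admissible_seq t m n ds"
  shows "\<exists>(\<C> :: 'a codeword set) \<U>. is_code t m n \<C> \<and> cw.dim \<C> = length ds \<and> gen_weights t m n \<C> = ds \<and>
    \<U> (length ds) = \<C> \<and> (\<forall>r \<le> length ds. subcode (\<U> r) \<C> \<and> cw.dim (\<U> r) = r \<and> \<U> r \<subseteq> \<U> (Suc r)) \<and>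
    (\<forall>r\<in>{1..length ds}. wt t m n (\<U> r) = gen_weight t m n \<C> r)"
proof -
  let ?N = "\<Sum>i = 1..t. n i"
  let ?k = "length ds"
  obtain vs where vs: "length vs = length ds" "distinct vs" "cw.independent (set vs)"
    "\<And>r. r < length ds \<Longrightarrow> vs ! r \<in> level (ds ! r)" using level_list[OF ds] by blast
  have dsN: "ds ! r \<in> {1..?N}" if "r < ?k" for r
    using ds that nth_mem[OF that] unfolding admissible_seq_def by blast
  have mono: "ds ! r \<le> ds ! s" if "r \<le> s" "s < ?k" for r s
    using ds that by (auto simp: admissible_seq_def sorted_iff_nth_mono)
  have pred: "r - 1 < ?k" if "r \<in> {1..?k}" for r using that by auto
  \<comment> \<open>\<open>take\<close> saturates, so \<open>\<U>\<close> is constant beyond the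
    length of the list and the inclusions of the flag hold for every index.\<close>
  define \<U> where "\<U> r = cw.span (set (take r vs))" for r
  let ?\<C> = "cw.span (set vs)"
  have amb: "set vs \<subseteq> ambient t m n"
  proof
    fix v assume "v \<in> set vs"
    then obtain r where "r < ?k" "v = vs ! r" using vs(1) by (auto simp: in_set_conv_nth)
    then show "v \<in> ambient t m n" using vs(4)[of r] corner_ambient by (auto simp: level_def)
  qed
  then have Camb: "?\<C> \<subseteq> ambient t m n" using subspace_ambient by (rule cw.span_minimal)
  then have code: "is_code t m n ?\<C>" by (simp add: is_code_def cw.subspace_span)
  have dimC: "cw.dim ?\<C> = ?k"
    using vs by (simp add: cw.dim_eq_card_independent distinct_card)
  have dimU: "cw.dim (\<U> r) = r" if "r \<le> ?k" for r
  proof -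
    have "cw.independent (set (take r vs))"
      using vs(3) set_take_subset by (rule cw.independent_mono)
    then show ?thesis
      using vs(1,2) that by (simp add: \<U>_def cw.dim_eq_card_independent distinct_card)
  qed
  have sub: "subcode (\<U> r) ?\<C>" for r
    by (simp add: \<U>_def subcode_def cw.span_mono set_take_subset)
  have Umono: "\<U> r \<subseteq> \<U> (Suc r)" for r
    unfolding \<U>_def by (intro cw.span_mono set_take_subset_set_take) simp
  have wtU: "wt t m n (\<U> r) \<le> ds ! (r - 1)" if r: "r \<in> {1..?k}" for r
  proof (rule wt_corner_le)
    show "ds ! (r - 1) \<le> ?N" using dsN[OF pred[OF r]] by simp
    have "set (take r vs) \<subseteq> corner (ds ! (r - 1))"
    proof
      fix v assume "v \<in> set (take r vs)"
      then obtain s where s: "s < r" "v = vs ! s" using r vs(1) by (auto simp: in_set_conv_nth)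
      then have "v \<in> corner (ds ! s)" using vs(4)[of s] r by (simp add: level_def)
      moreover have "ds ! s \<le> ds ! (r - 1)" using mono[OF _ pred[OF r], of s] s(1) by simp
      ultimately show "v \<in> corner (ds ! (r - 1))" using corner_mono by blast
    qed
    then show "\<U> r \<subseteq> corner (ds ! (r - 1))"
      unfolding \<U>_def using subspace_corner by (rule cw.span_minimal)
  qed
  have lower: "ds ! (r - 1) \<le> wt t m n \<V>"
    if r: "r \<in> {1..?k}" and V: "subcode \<V> ?\<C>" "r \<le> cw.dim \<V>" for r \<V>
  proof (rule ccontr)
    assume lt: "\<not> ?thesis"
    let ?s = "Suc (wt t m n \<V>)"
    have sN: "?s \<in> {1..?N}" using lt dsN[OF pred[OF r]] by auto
    have Vs: "cw.subspace \<V>" "\<V> \<subseteq> ambient t m n" "\<V> \<subseteq> ?\<C>"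
      using V(1) Camb by (auto simp: subcode_def)
    obtain \<A> where \<A>: "\<forall>i\<in>{1..t}. OAC (m i) (n i) (\<A> i)" "\<V> \<subseteq> prod_code t \<A>"
      "wt t m n \<V> = (\<Sum>i=1..t. max_rk (m i) (n i) (\<A> i))"
      using wt_attained[OF Vs(2)] .
    \<comment> \<open>Positions start at 0, so these are the vectors for the \<open>r\<close>-th
      entry onwards. Their levels are at least \<open>?s\<close>, hence \<open>?W\<close> lies in
      \<open>D ?s\<close>, and its dimension is \<open>?k - (r - 1)\<close>. Added to the dimension
      of \<open>\<V>\<close>, at least \<open>r\<close>, this exceeds \<open>?k\<close>, so the two
      would have to meet nontrivially.\<close>
    let ?W = "cw.span (set (drop (r - 1) vs))"
    have "set (drop (r - 1) vs) \<subseteq> D ?s"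
    proof
      fix v assume "v \<in> set (drop (r - 1) vs)"
      then obtain s where s: "r - 1 \<le> s" "s < ?k" "v = vs ! s"
        using vs(1) by (auto simp: in_set_conv_nth) (metis le_add1 add.commute less_diff_conv)
      have "?s \<le> ds ! s" using lt mono[OF s(1,2)] by simp
      then have "D (ds ! s) \<subseteq> D ?s" using dsN[OF s(2)] by (intro D_antimono) auto
      then show "v \<in> D ?s" using vs(4)[OF s(2)] s(3) by (auto simp: level_def)
    qed
    then have WD: "?W \<subseteq> D ?s" using D_code(2)[OF sN] by (rule cw.span_minimal)
    have "\<V> \<inter> ?W \<subseteq> {0}"
    proof
      fix C assume C: "C \<in> \<V> \<inter> ?W"
      then have "srk t m n C \<le> wt t m n \<V>"
        unfolding \<A>(3) using srk_prod_code_le[OF \<A>(1)] \<A>(2) by blast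
      then show "C \<in> {0}" using D_srk_less_imp_zero[OF sN, of C] C WD by auto
    qed
    then have "card (\<V> \<inter> ?W) \<le> 1" using card_mono[of "{0}" "\<V> \<inter> ?W"] by simp
    have WC: "?W \<subseteq> ?\<C>" by (intro cw.span_mono set_drop_subset)
    have "card \<V> * card ?W \<le> card (\<V> \<inter> ?W) * card ?\<C>"
      by (rule card_Int_ge[OF finite_subset[OF Camb finite_ambient] Vs(3) WC])
         (auto intro: cw.span_add cw.span_diff cw.subspace_diff[OF Vs(1)])
    also have "\<dots> \<le> 1 * card ?\<C>" using \<open>card (\<V> \<inter> ?W) \<le> 1\<close> by (intro mult_right_mono) auto
    also have "card ?\<C> = CARD('a) ^ ?k"
      using card_cw[OF cw.subspace_span Camb] dimC by simp
    also have "card ?W = CARD('a) ^ (?k - (r - 1))"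
    proof -
      have "cw.independent (set (drop (r - 1) vs))"
        using vs(3) set_drop_subset by (rule cw.independent_mono)
      moreover have "card (set (drop (r - 1) vs)) = ?k - (r - 1)"
        using vs(1,2) by (simp add: distinct_card)
      ultimately show ?thesis
        using cw.card_span_independent[of "set (drop (r - 1) vs)"] by simp
    qed
    finally have "CARD('a) ^ (cw.dim \<V> + (?k - (r - 1))) \<le> CARD('a) ^ ?k"
      using card_cw[OF Vs(1,2)] by (simp add: power_add)
    then have "cw.dim \<V> + (?k - (r - 1)) \<le> ?k" by (simp only: card_field_power_le_iff)
    then show False using V(2) r by auto
  qed
  have gw: "gen_weight t m n ?\<C> r = ds ! (r - 1) \<and> wt t m n (\<U> r) = gen_weight t m n ?\<C> r"
    if r: "r \<in> {1..?k}" for r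
  proof -
    have "r \<le> cw.dim ?\<C>" using r dimC by simp
    from gen_weight_attained[OF cw.subspace_span this, of t m n] obtain \<V>
      where "subcode \<V> ?\<C>" "r \<le> cw.dim \<V>" "wt t m n \<V> = gen_weight t m n ?\<C> r" .
    then have "ds ! (r - 1) \<le> gen_weight t m n ?\<C> r" using lower[OF r, of \<V>] by simp
    moreover have "gen_weight t m n ?\<C> r \<le> wt t m n (\<U> r)"
      using dimU r by (intro gen_weight_le sub) simp
    ultimately show ?thesis using wtU[OF r] by simp
  qed
  have gws: "gen_weights t m n ?\<C> = ds"
    by (rule nth_equalityI) (use gw dimC in \<open>auto simp: gen_weights_def simp del: upt_Suc\<close>)
  have Uk: "\<U> ?k = ?\<C>" by (simp add: \<U>_def vs(1)[symmetric])
  show ?thesis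
    by (rule exI[of _ ?\<C>], rule exI[of _ \<U>])
       (intro conjI allI ballI impI code dimC gws Uk sub dimU Umono gw[THEN conjunct2])
qed

end

section \<open>Greedy weights and the chain condition from a flag\<close>

lemma greedy_weights_eq_gen_weights:
  fixes \<U> :: "nat \<Rightarrow> 'a::field codeword set"
  assumes U: "\<And>r. r \<le> cw.dim \<C> \<Longrightarrow> subcode (\<U> r) \<C> \<and> cw.dim (\<U> r) = r \<and> \<U> r \<subseteq> \<U> (Suc r)"
    and wt: "\<And>r. r \<in> {1..cw.dim \<C>} \<Longrightarrow> wt t m n (\<U> r) = gen_weight t m n \<C> r"
  shows "greedy_weights t m n \<C> = gen_weights t m n \<C>"
proof -
  have greedy: "r \<in> {1..cw.dim \<C>} \<Longrightarrow> \<U> r \<in> greedy_subcodes t m n \<C> r" for r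
  proof (induction r)
    case (Suc r)
    show ?case
    proof (cases r)
      case 0
      then show ?thesis using U[of 1] wt[of 1] Suc.prems by simp
    next
      case (Suc s)
      let ?r = "Suc (Suc s)"
      have r: "?r \<in> {1..cw.dim \<C>}" using Suc.prems Suc by simp
      have "\<U> (Suc s) \<in> greedy_subcodes t m n \<C> (Suc s)" using Suc.IH Suc r by simp
      moreover have "\<U> (Suc s) \<subseteq> \<U> ?r" using U[of "Suc s"] r by simp
      \<comment> \<open>\<open>\<U> ?r\<close> attains the generalized weight, so it is minimal
        among all subcodes of its dimension, in particular among those containing some greedy
        subcode.\<close>
      moreover have "wt t m n (\<U> ?r) \<le> wt t m n \<V>" if "subcode \<V> \<C>" "cw.dim \<V> = ?r" for \<V>
        using wt[OF r] gen_weight_le[OF that(1), of ?r t m n] that(2) by simp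
      ultimately show ?thesis using U[of ?r] r Suc by (auto simp: Let_def)
    qed
  qed simp
  have "greedy_weight t m n \<C> r = gen_weight t m n \<C> r" if r: "r \<in> {1..cw.dim \<C>}" for r
  proof -
    have "(SOME \<V>. \<V> \<in> greedy_subcodes t m n \<C> r) \<in> greedy_subcodes t m n \<C> r"
      using greedy[OF r] by (rule someI)
    from greedy_subcodes_wt_unique[OF this greedy[OF r]]
    show ?thesis using wt[OF r] by (simp add: greedy_weight_def)
  qed
  then show ?thesis by (auto simp: greedy_weights_def gen_weights_def simp del: upt_Suc)
qed

lemma chain_conditionI:
  fixes \<U> :: "nat \<Rightarrow> 'a::field codeword set"
  assumes C: "cw.subspace \<C>" "0 < cw.dim \<C>" "\<U> (cw.dim \<C>) = \<C>"
    and U: "\<And>r. r \<le> cw.dim \<C> \<Longrightarrow> subcode (\<U> r) \<C> \<and> cw.dim (\<U> r) = r \<and> \<U> r \<subseteq> \<U> (Suc r)"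
    and wt: "\<And>r. r \<in> {1..cw.dim \<C>} \<Longrightarrow> wt t m n (\<U> r) = gen_weight t m n \<C> r"
  shows "chain_condition t m n \<C>" "\<C> \<noteq> {0}"
proof -
  have dim0: "cw.dim ({0} :: 'a codeword set) = 0"
    using cw.dim_le_card[of "{0}" "{}"] by simp
  then show ne: "\<C> \<noteq> {0}" using C(2) by force
  have U1: "subcode (\<U> 1) \<C>" "cw.dim (\<U> 1) = 1" using U[of 1] C(2) by simp_all
  have "{0} \<subseteq> \<U> 1" using U1(1) cw.subspace_0[of "\<U> 1"] by (simp add: subcode_def)
  moreover have "\<U> 1 \<noteq> {0}" using U1(2) dim0 by force
  ultimately have "{0} \<subset> \<U> 1" by blast
  moreover have "\<U> r \<subset> \<U> (Suc r)" if "r \<in> {1..<cw.dim \<C>}" for r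
  proof -
    have "cw.dim (\<U> r) \<noteq> cw.dim (\<U> (Suc r))" using U[of r] U[of "Suc r"] that by simp
    then show ?thesis using U[of r] that by auto
  qed
  ultimately show "chain_condition t m n \<C>"
    using ne C(3) U wt unfolding chain_condition_def by (intro conjI exI[of _ \<U>]) simp_all
qed

theorem theorem4p10:
  fixes t :: nat and m n :: "nat \<Rightarrow> nat"
    and D :: "nat \<Rightarrow> 'a::{finite,field} codeword set"
  assumes t_pos: "0 < t"
    and n_pos: "\<And>i. i \<in> {1..t} \<Longrightarrow> 0 < n i"
    and m_pos: "\<And>i. i \<in> {1..t} \<Longrightarrow> 0 < m i"
    and m_ge_n: "\<And>i. i \<in> {1..t} \<Longrightarrow> n i \<le> m i"
    and m_decr: "\<And>i j. 1 \<le> i \<Longrightarrow> i \<le> j \<Longrightarrow> j \<le> t \<Longrightarrow> m j \<le> m i"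
    and D_first: "D 1 = ambient t m n"
    and D_chain: "\<And>h. 1 \<le> h \<Longrightarrow> h < (\<Sum>i = 1..t. n i) \<Longrightarrow> D (Suc h) \<subseteq> D h"
    and D_MSRD: "\<And>h. h \<in> {1..\<Sum>i = 1..t. n i} \<Longrightarrow> MSRD t m n (D h) \<and> min_dist t m n (D h) = h"
  shows
    "(\<forall>ds. (\<forall>d\<in>set ds. 0 < d) \<longrightarrow>
        ((\<exists>\<C> :: 'a codeword set. is_code t m n \<C> \<and> gen_weights t m n \<C> = ds)
           \<longleftrightarrow> admissible_seq t m n ds)) \<and>
     (\<forall>ds. ds \<noteq> [] \<and> admissible_seq t m n ds \<longrightarrow>
        (\<exists>\<C> :: 'a codeword set. is_code t m n \<C> \<and> gen_weights t m n \<C> = ds \<and>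
           chain_condition t m n \<C>)) \<and>
     (\<forall>ds. ds \<noteq> [] \<and> subseq ds (gen_weights t m n (ambient t m n :: 'a codeword set)) \<longrightarrow>
        (\<exists>\<C> :: 'a codeword set. is_code t m n \<C> \<and> \<C> \<noteq> {0} \<and> greedy_weights t m n \<C> = ds))"
proof -
  interpret MSRD_chain t m n D
    by unfold_locales (use n_pos m_ge_n m_decr D_chain D_MSRD in auto)
  have forward: "admissible_seq t m n ds"
    if "is_code t m n \<C>" "gen_weights t m n \<C> = ds" for ds and \<C> :: "'a codeword set"
    using admissible_gen_weights[OF that(1)] that(2) by simp
  \<comment> \<open>The empty sequence belongs to the zero code, which
    \<open>chain_condition\<close> excludes; hence the guard \<open>ds \<noteq> []\<close>.\<close>
  have backward: "\<exists>\<C> :: 'a codeword set. is_code t m n \<C> \<and> gen_weights t m n \<C> = ds \<and>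
      (ds \<noteq> [] \<longrightarrow> chain_condition t m n \<C> \<and> \<C> \<noteq> {0}) \<and> greedy_weights t m n \<C> = ds"
    if adm: "admissible_seq t m n ds" for ds
  proof -
    obtain \<C> :: "'a codeword set" and \<U> where C: "is_code t m n \<C>" "cw.dim \<C> = length ds"
      "gen_weights t m n \<C> = ds" "\<U> (length ds) = \<C>"
      and U: "\<And>r. r \<le> length ds \<Longrightarrow> subcode (\<U> r) \<C> \<and> cw.dim (\<U> r) = r \<and> \<U> r \<subseteq> \<U> (Suc r)"
        "\<And>r. r \<in> {1..length ds} \<Longrightarrow> wt t m n (\<U> r) = gen_weight t m n \<C> r"
      using code_with_gen_weights[OF adm] by blast
    have "greedy_weights t m n \<C> = ds"
      using greedy_weights_eq_gen_weights[of \<C> \<U> t m n] U C(2,3) by simp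
    moreover have "chain_condition t m n \<C> \<and> \<C> \<noteq> {0}" if "ds \<noteq> []"
      using chain_conditionI[of \<C> \<U> t m n] U C that by (simp add: is_code_def)
    ultimately show ?thesis using C by blast
  qed
  \<comment> \<open>Necessity applied to the whole space makes its sequence admissible.
    Admissibility passes to subsequences, so the claim on greedy weights reduces to the
    construction.\<close>
  have "is_code t m n (ambient t m n :: 'a codeword set)"
    by (simp add: is_code_def subspace_ambient)
  from admissible_gen_weights[OF this]
  have sub: "admissible_seq t m n ds"
    if "subseq ds (gen_weights t m n (ambient t m n :: 'a codeword set))" for ds
    using that by (rule admissible_subseq)
  show ?thesis
  proof (intro conjI allI impI)
    fix ds
    show "(\<exists>\<C> :: 'a codeword set. is_code t m n \<C> \<and> gen_weights t m n \<C> = ds) \<longleftrightarrow> admissible_seq t m n ds"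
      using forward backward by blast
  next
    fix ds assume "ds \<noteq> [] \<and> admissible_seq t m n ds"
    then show "\<exists>\<C> :: 'a codeword set. is_code t m n \<C> \<and> gen_weights t m n \<C> = ds \<and> chain_condition t m n \<C>"
      using backward by blast
  next
    fix ds assume "ds \<noteq> [] \<and> subseq ds (gen_weights t m n (ambient t m n :: 'a codeword set))"
    then show "\<exists>\<C> :: 'a codeword set. is_code t m n \<C> \<and> \<C> \<noteq> {0} \<and> greedy_weights t m n \<C> = ds"
      using backward sub by blast
  qed
qed

end
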